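(* Let $A$ be a unital semi-simple commutative Banach algebra, $U$ an automorphism of $A$, and $w \in A$. Let $T = wU$ and let $\check{T}$ be the associated weighted composition operator on $\check{A}$. Assume that (a) $w$ is an invertible element of $A$, and (b) $\sigma(\check{T}) = \mathbb{T} \subseteq \sigma(T)$. Then the set $\sigma(T)$ is connected.
   Context: $A$ is a unital commutative semi-simple Banach algebra with maximal ideal space $\mathfrak{M}_A$ and Shilov boundary $\partial A$. For $f\in A$, $\check f$ is the restriction of the Gelfand transform $\hat f$ to $\partial A$; $\check A$ is the closure of $\{\check f: f\in A\}$ in $C(\partial A)$ with sup norm. The automorphism $U$ induces a homeomorphism $\varphi$ of $\mathfrak{M}_A$ by $\widehat{Uf}(m)=\hat f(\varphi(m))$, with $\varphi(\partial A)=\partial A$. $T=wU$ means $Tf=w\cdot Uf$; $\check T$ is the operator on $\check A$ given by $(\check Tg)(t)=\check w(t)g(\varphi(t))$, $t\in\partial A$. $\mathbb{T}$ is the unit circle. *)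

theory Defs
  imports "HOL-Analysis.Analysis"
begin

text \<open>A complex unital commutative Banach algebra is modelled as a type
  'a of class real_normed_algebra_1, comm_ring_1, banach together with an element j
  with j * j = -1 inducing the complex scalar multiplication, with the norm
  homogeneous for complex scalars.\<close>

definition cscale :: "'a::real_normed_algebra_1 \<Rightarrow> complex \<Rightarrow> 'a \<Rightarrow> 'a" where
  "cscale j c x = (of_real (Re c) + of_real (Im c) * j) * x"

definition complex_structure :: "'a::{real_normed_algebra_1,comm_ring_1,banach} \<Rightarrow> bool" where
  "complex_structure j \<longleftrightarrow> j * j = -1 \<and> (\<forall>c x. norm (cscale j c x) = cmod c * norm x)"

definition is_ideal :: "'a::comm_ring_1 set \<Rightarrow> bool" where
  "is_ideal I \<longleftrightarrow> 0 \<in> I \<and> (\<forall>x\<in>I. \<forall>y\<in>I. x + y \<in> I) \<and> (\<forall>a. \<forall>x\<in>I. a * x \<in> I)"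

definition maximal_ideal :: "'a::comm_ring_1 set \<Rightarrow> bool" where
  "maximal_ideal I \<longleftrightarrow> is_ideal I \<and> I \<noteq> UNIV \<and>
     (\<forall>J. is_ideal J \<and> I \<subseteq> J \<and> J \<noteq> UNIV \<longrightarrow> J = I)"

definition semisimple :: "'a::comm_ring_1 itself \<Rightarrow> bool" where
  "semisimple _ \<longleftrightarrow> \<Inter>{I::'a set. maximal_ideal I} = {0}"

text \<open>Maximal ideal space: nonzero complex-linear multiplicative functionals, with the
  Gelfand (weak-star) topology = topology of pointwise convergence, i.e. the subspace
  topology of the product topology on 'a => complex.  The Gelfand transform of f is
  (\<lambda>m. m f).\<close>

definition max_ideal_space :: "'a::{real_normed_algebra_1,comm_ring_1,banach} \<Rightarrow> ('a \<Rightarrow> complex) set" where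
  "max_ideal_space j = {m. (\<forall>x y. m (x + y) = m x + m y) \<and> (\<forall>x y. m (x * y) = m x * m y) \<and>
      (\<forall>c x. m (cscale j c x) = c * m x) \<and> m 1 = 1}"

definition is_boundary :: "'a::{real_normed_algebra_1,comm_ring_1,banach} \<Rightarrow> ('a \<Rightarrow> complex) set \<Rightarrow> bool" where
  "is_boundary j B \<longleftrightarrow> B \<subseteq> max_ideal_space j \<and>
     (\<forall>f. \<exists>m\<in>B. \<forall>m'\<in>max_ideal_space j. cmod (m' f) \<le> cmod (m f))"

definition shilov_boundary :: "'a::{real_normed_algebra_1,comm_ring_1,banach} \<Rightarrow> ('a \<Rightarrow> complex) set" where
  "shilov_boundary j = \<Inter>{B. is_boundary j B \<and> closedin (top_of_set (max_ideal_space j)) B}"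

text \<open>Elements of the uniform closure A-check of the restricted Gelfand transforms,
  represented as functions on the Shilov boundary (extended by 0 outside it).\<close>

definition check_alg :: "'a::{real_normed_algebra_1,comm_ring_1,banach} \<Rightarrow> (('a \<Rightarrow> complex) \<Rightarrow> complex) set" where
  "check_alg j = {g. (\<forall>t. t \<notin> shilov_boundary j \<longrightarrow> g t = 0) \<and>
      (\<forall>\<epsilon>>0. \<exists>f. \<forall>t\<in>shilov_boundary j. cmod (g t - t f) < \<epsilon>)}"

definition check_op :: "'a::{real_normed_algebra_1,comm_ring_1,banach} \<Rightarrow> 'a \<Rightarrow> ('a \<Rightarrow> 'a)
     \<Rightarrow> (('a \<Rightarrow> complex) \<Rightarrow> complex) \<Rightarrow> (('a \<Rightarrow> complex) \<Rightarrow> complex)" where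
  "check_op j w U g = (\<lambda>t. if t \<in> shilov_boundary j then t w * g (t \<circ> U) else 0)"

definition op_spectrum :: "'a::{real_normed_algebra_1,comm_ring_1,banach} \<Rightarrow> ('a \<Rightarrow> 'a) \<Rightarrow> complex set" where
  "op_spectrum j T = {lam. \<not> (\<exists>S. (\<forall>x. S (T x - cscale j lam x) = x) \<and>
      (\<forall>x. T (S x) - cscale j lam (S x) = x) \<and> (\<exists>K. \<forall>x. norm (S x) \<le> K * norm x))}"

definition check_spectrum :: "'a::{real_normed_algebra_1,comm_ring_1,banach} \<Rightarrow>
    ((('a \<Rightarrow> complex) \<Rightarrow> complex) \<Rightarrow> (('a \<Rightarrow> complex) \<Rightarrow> complex)) \<Rightarrow> complex set" where
  "check_spectrum j Tc = (let C = check_alg j; D = shilov_boundary j in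
     {lam. \<not> (\<exists>S. (\<forall>g\<in>C. S g \<in> C) \<and>
        (\<forall>g\<in>C. S (\<lambda>t. Tc g t - lam * g t) = g) \<and>
        (\<forall>g\<in>C. (\<lambda>t. Tc (S g) t - lam * S g t) = g) \<and>
        (\<exists>K. \<forall>g\<in>C. (SUP t\<in>D. cmod (S g t)) \<le> K * (SUP t\<in>D. cmod (g t))))})"

definition algebra_automorphism :: "'a::{real_normed_algebra_1,comm_ring_1,banach} \<Rightarrow> ('a \<Rightarrow> 'a) \<Rightarrow> bool" where
  "algebra_automorphism j U \<longleftrightarrow> bij U \<and> (\<forall>x y. U (x + y) = U x + U y) \<and>
     (\<forall>x y. U (x * y) = U x * U y) \<and> (\<forall>c x. U (cscale j c x) = cscale j c (U x)) \<and> U 1 = 1"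

end

theory Submission
  imports Defs "HOL-Complex_Analysis.Complex_Analysis"
begin

text \<open>
  Let \<open>S\<^sub>c\<close> be the resolvent of the operator that \<open>T\<close> induces on the closure of the restrictions to
  the Shilov boundary. A loop in the resolvent set of \<open>T\<close> that stays inside the open unit disc can
  only wind around points \<open>z\<close> of the resolvent set: the Cauchy integral of \<open>(T - c)\<inverse> f\<close> along
  the loop is an element of the algebra; for \<open>t\<close> in the Shilov boundary, \<open>c \<mapsto> S\<^sub>c f t\<close> is
  holomorphic on the whole disc, so the integral restricts to a multiple of \<open>S\<^sub>z f\<close>; and as the
  restriction map is injective, it solves \<open>(T - z) g = f\<close> up to a factor. Hence all components of
  the resolvent set within the disc are simply connected, and therefore the union of the spectrum
  with the exterior of the disc is connected. The same applies to \<open>T\<inverse>\<close>, which is again a weighted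
  automorphism, so no part of the spectrum can be split off from the unit circle, neither inside
  nor outside the disc.
\<close>

section \<open>Plane topology\<close>

text \<open>The obstacle is that the restrictions of elements of the algebra need not exhaust their
  closure: throughout the disc the resolvent of \<open>check_op j w U\<close> produces functions on
  the Shilov boundary, but nothing says that they come from the algebra. Only on the loop do both
  resolvents exist and agree, and Cauchy's formula carries this information to \<open>z\<close>. The
  loops are polynomial so that the algebra-valued integral is an ordinary one over
  \<open>{0..1}\<close> with a continuous integrand. Injectivity of the restriction rests on
  semisimplicity. That notion speaks of maximal ideals, and the Shilov boundary is defined as a mere
  intersection; hence the Gelfand-Mazur theorem and the proof that this intersection is a boundary.
  The exterior of the disc is adjoined to the spectrum because the filling argument works only
  within the disc; at the end the circle, which lies in the spectrum, keeps the two sides apart.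
  Invertibility of \<open>w\<close> makes the inverse operator available, and
  \<open>z \<mapsto> 1 / z\<close> exchanges the two sides.\<close>

lemma connected_Compl_if_loops_filled:
  fixes S :: "complex set"
  assumes "open S" "bounded S"
    and filled: "\<And>p z. \<lbrakk>polynomial_function p; pathfinish p = pathstart p; path_image p \<subseteq> S;
      z \<notin> path_image p; winding_number p z \<noteq> 0\<rbrakk> \<Longrightarrow> z \<in> S"
  shows "connected (- S)"
proof -
  have filled_path: "z \<in> S"
    if g: "path g" "pathfinish g = pathstart g" "path_image g \<subseteq> S" "z \<notin> path_image g"
      "winding_number g z \<noteq> 0" for g z
  proof -
    \<comment> \<open>The distance \<open>e\<close> from the loop to this closed set serves twice:
      an \<open>e\<close>-close polynomial loop stays in \<open>S\<close>, and it is too close to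
      \<open>g\<close> to have another winding number about \<open>z\<close>.\<close>
    define K where "K = (- S) \<union> {z}"
    have "closed K"
      using \<open>open S\<close> by (simp add: K_def closed_Compl)
    moreover have "path_image g \<inter> K = {}"
      using g by (auto simp: K_def)
    ultimately obtain e where e: "e > 0" "\<And>x y. x \<in> path_image g \<Longrightarrow> y \<in> K \<Longrightarrow> e \<le> dist x y"
      using separate_compact_closed[OF compact_path_image[OF g(1)], of K] by blast
    obtain p where p: "polynomial_function p" "pathstart p = pathstart g" "pathfinish p = pathfinish g"
      "\<And>t. t \<in> {0..1} \<Longrightarrow> norm (p t - g t) < e"
      using path_approx_polynomial_function[OF g(1) e(1)] by metis
    have notK: "p t \<notin> K" if t: "t \<in> {0..1}" for t
    proof
      assume "p t \<in> K"
      then have "e \<le> dist (g t) (p t)"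
        using e(2) t by (auto simp: path_image_def)
      then show False
        using p(4)[OF t] by (simp add: dist_norm norm_minus_commute)
    qed
    have "winding_number p z = winding_number g z"
    proof (rule winding_number_nearby_paths_eq)
      show "path p"
        using p(1) by (simp add: path_polynomial_function)
      fix t :: real
      assume t: "t \<in> {0..1}"
      then have "e \<le> dist (g t) z"
        using e(2) by (auto simp: path_image_def K_def)
      then show "norm (p t - g t) < norm (g t - z)"
        using p(4)[OF t] by (simp add: dist_norm)
    qed (use g p in auto)
    moreover have "path_image p \<subseteq> S" "z \<notin> path_image p"
      using notK by (force simp: path_image_def K_def)+
    ultimately show ?thesis
      using filled[of p z] p g by simp
  qed
  have "simply_connected C" if C: "C \<in> components S" for C
  proof -
    have "open C"
      using C \<open>open S\<close> open_components by blast
    have "winding_number g z = 0"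
      if g: "path g" "path_image g \<subseteq> C" "pathfinish g = pathstart g" and "z \<notin> C" for g z
    proof (rule ccontr)
      assume nz: "winding_number g z \<noteq> 0"
      \<comment> \<open>All of \<open>Z\<close> shares the winding number of \<open>z\<close>, so
        \<open>Z\<close> lies in \<open>S\<close>. Its frontier is nonempty and lies on the loop,
        which attaches \<open>Z\<close> to \<open>C\<close>; as \<open>C\<close> is a whole
        component of \<open>S\<close>, this forces \<open>z\<close> into \<open>C\<close>.\<close>
      define Z where "Z = connected_component_set (- path_image g) z"
      have zg: "z \<in> - path_image g"
        using g \<open>z \<notin> C\<close> by blast
      then have zZ: "z \<in> Z"
        by (simp add: Z_def connected_component_refl)
      have ZS: "Z \<subseteq> S"
      proof
        fix y assume y: "y \<in> Z"
        have "winding_number g constant_on Z"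
          by (rule winding_number_constant)
            (use g in \<open>auto simp: Z_def connected_component_in dest: connected_component_in\<close>)
        then have "winding_number g y = winding_number g z"
          using y zZ unfolding constant_on_def by metis
        moreover have "y \<notin> path_image g"
          using y connected_component_in unfolding Z_def by fastforce
        ultimately show "y \<in> S"
          using filled_path[of g y] g nz in_components_subset[OF C] by auto
      qed
      have op: "open (- path_image g)"
        using g(1) closed_path_image by blast
      then have "open Z"
        unfolding Z_def by (rule open_connected_component)
      have fr: "frontier Z \<subseteq> path_image g"
      proof -
        have "Z \<in> components (- path_image g)"
          using zg Z_def componentsI by blast
        then have "frontier Z \<subseteq> frontier (- path_image g)"
          using frontier_of_components_subset by blast
        then show ?thesis
          using op g(1) closed_path_image frontier_complement frontier_subset_closed by blast
      qed
      have "Z \<noteq> UNIV"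
        using \<open>bounded S\<close> ZS not_bounded_UNIV bounded_subset by blast
      then have "frontier Z \<noteq> {}"
        using zZ frontier_eq_empty by blast
      then have "closure Z \<inter> C \<noteq> {}"
        using fr g(2) by (auto simp: frontier_def)
      then have "connected (C \<union> closure Z)"
        using in_components_connected[OF C]
        by (intro connected_Un connected_imp_connected_closure) (auto simp: Z_def)
      moreover have "C \<union> closure Z \<subseteq> S"
        using ZS fr g(2) in_components_subset[OF C] \<open>open Z\<close> closure_Un_frontier[of Z] by blast
      moreover have "C \<inter> (C \<union> closure Z) \<noteq> {}"
        using in_components_nonempty[OF C] by blast
      ultimately have "C \<union> closure Z \<subseteq> C"
        using components_maximal[OF C] by blast
      then show False
        using zZ \<open>z \<notin> C\<close> closure_subset by blast
    qed
    then show ?thesis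
      using simply_connected_eq_winding_number_zero[OF \<open>open C\<close>] in_components_connected[OF C] by blast
  qed
  \<comment> \<open>For an open set, simple connectedness of all components is the Borsukian
    property, and a bounded open Borsukian set does not separate the plane.\<close>
  then show ?thesis
    using Borsukian_eq_simply_connected[OF \<open>open S\<close>] Borsukian_separation_open_closed[of S] assms by blast
qed

section \<open>The closed graph theorem\<close>

text \<open>Baire's theorem puts a ball into some \<open>A n\<close>. This does not bound
  \<open>F\<close> directly but gives every \<open>x\<close> arbitrarily good approximants with
  bounded image (\<open>approx\<close>); summing a series of them, with the closed graph at the
  limit, bounds \<open>F x\<close> itself.\<close>

theorem closed_graph_bounded_linear:
  fixes F :: "'a::banach \<Rightarrow> 'b::banach"
  assumes "linear F"
    and closed_graph: "\<And>X x y. \<lbrakk>X \<longlonglongrightarrow> x; (\<lambda>n. F (X n)) \<longlonglongrightarrow> y\<rbrakk> \<Longrightarrow> F x = y"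
  shows "bounded_linear F"
proof -
  interpret linear F by fact
  define A where "A n = closure {x. norm (F x) \<le> real n}" for n
  have union: "(\<Union>n. A n) = UNIV"
  proof -
    have "x \<in> A (nat \<lceil>norm (F x)\<rceil>)" for x
      unfolding A_def by (rule subsetD[OF closure_subset]) (simp add: of_nat_nat)
    then show ?thesis by blast
  qed
  have "\<not> (\<forall>n. interior (A n) = {})"
  proof
    assume "\<forall>n. interior (A n) = {}"
    then have "euclidean interior_of (\<Union>n. A n) = {}"
      by (intro Baire_category_alt) (auto simp: completely_metrizable_space_euclidean A_def)
    then show False
      unfolding union by simp
  qed
  then obtain n where "interior (A n) \<noteq> {}"
    by blast
  then obtain x0 r where r: "r > 0" "ball x0 r \<subseteq> A n"
    by (auto simp: interior_def open_contains_ball) (metis subset_trans)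
  \<comment> \<open>Scaling by the \<open>c\<close> below gives \<open>x\<close> length
    \<open>r / 2\<close>. Two values of norm at most \<open>n\<close> differ by at most
    \<open>2 * n\<close>, and \<open>2 * n / c\<close> is \<open>4 * n / r * norm x\<close>.\<close>
  define K where "K = 4 * real n / r"
  have "K \<ge> 0" using r by (simp add: K_def)
  have approx: "\<exists>y. norm (x - y) \<le> \<epsilon> \<and> norm (F y) \<le> K * norm x" if "\<epsilon> > 0" for x \<epsilon>
  proof (cases "x = 0")
    case True
    then show ?thesis
      using that by (intro exI[of _ 0]) (auto simp: zero)
  next
    case False
    define c where "c = r / (2 * norm x)"
    have c: "c > 0" using False r by (simp add: c_def)
    have "x0 + c *\<^sub>R x \<in> ball x0 r" "x0 \<in> ball x0 r"
      using r False by (auto simp: dist_norm c_def)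
    then have "x0 + c *\<^sub>R x \<in> A n" "x0 \<in> A n"
      using r by auto
    moreover have "c * \<epsilon> / 2 > 0"
      using c that by simp
    ultimately obtain u v where uv: "norm (F u) \<le> n" "dist u (x0 + c *\<^sub>R x) < c * \<epsilon> / 2"
        "norm (F v) \<le> n" "dist v x0 < c * \<epsilon> / 2"
      unfolding A_def closure_approachable by blast
    define y where "y = (1/c) *\<^sub>R (u - v)"
    have "x - y = (1/c) *\<^sub>R ((x0 + c *\<^sub>R x - u) - (x0 - v))"
      using c by (simp add: y_def algebra_simps)
    then have "norm (x - y) \<le> (1/c) * (norm (x0 + c *\<^sub>R x - u) + norm (x0 - v))"
      using c norm_triangle_ineq4[of "x0 + c *\<^sub>R x - u" "x0 - v"] by (simp add: divide_right_mono)
    also have "\<dots> \<le> (1/c) * (c * \<epsilon> / 2 + c * \<epsilon> / 2)"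
      using uv c by (intro mult_left_mono add_mono) (auto simp: dist_norm norm_minus_commute)
    finally have 1: "norm (x - y) \<le> \<epsilon>"
      using c by simp
    have "norm (F y) = (1/c) * norm (F u - F v)"
      using c by (simp add: y_def scale diff)
    also have "\<dots> \<le> (1/c) * (n + n)"
      using uv c norm_triangle_ineq4[of "F u" "F v"] by (intro mult_left_mono) auto
    also have "\<dots> = K * norm x"
      using r False by (simp add: K_def c_def field_simps)
    finally show ?thesis
      using 1 by blast
  qed
  define g where "g x \<epsilon> = (SOME y. norm (x - y) \<le> \<epsilon> \<and> norm (F y) \<le> K * norm x)" for x \<epsilon>
  have g: "norm (x - g x \<epsilon>) \<le> \<epsilon>" "norm (F (g x \<epsilon>)) \<le> K * norm x" if "\<epsilon> > 0" for x \<epsilon>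
    using someI_ex[OF approx[OF that, of x]] by (auto simp: g_def)
  have bound1: "norm (F x) \<le> 2 * K" if "norm x \<le> 1" for x
  proof -
    \<comment> \<open>\<open>X k\<close> is the error left after \<open>k\<close> corrections
      \<open>Y\<close>. Halving it each time makes the bounds \<open>K / 2 ^ k\<close> on the images
      sum to \<open>2 * K\<close>.\<close>
    define X where "X = rec_nat x (\<lambda>k u. u - g u ((1/2) ^ Suc k))"
    define Y where "Y k = g (X k) ((1/2) ^ Suc k)" for k
    have X0: "X 0 = x" and XS: "X (Suc k) = X k - Y k" for k
      by (simp_all add: X_def Y_def)
    have Xn: "norm (X k) \<le> (1/2) ^ k" for k
    proof (cases k)
      case 0 then show ?thesis using that by (simp add: X0)
    next
      case (Suc i)
      then show ?thesis
        using g(1)[of "(1/2) ^ Suc i" "X i"] by (simp add: XS Y_def)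
    qed
    have sumY: "(\<Sum>i<k. Y i) = x - X k" for k
      by (induction k) (auto simp: X0 XS)
    have "X \<longlonglongrightarrow> 0"
    proof (rule Lim_null_comparison)
      show "\<forall>\<^sub>F k in sequentially. norm (X k) \<le> (1/2) ^ k"
        using Xn by simp
      show "(\<lambda>k. (1/2) ^ k :: real) \<longlonglongrightarrow> 0"
        by (simp add: LIMSEQ_power_zero)
    qed
    then have "(\<lambda>k. \<Sum>i<k. Y i) \<longlonglongrightarrow> x"
      unfolding sumY using tendsto_diff[of "\<lambda>_. x" x sequentially X 0] by simp
    moreover have FY: "norm (F (Y k)) \<le> K * (1/2) ^ k" for k
      using g(2)[of "(1/2) ^ Suc k" "X k"] mult_left_mono[OF Xn \<open>K \<ge> 0\<close>, of k]
      by (auto simp: Y_def)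
    have sK: "summable (\<lambda>k. K * (1/2) ^ k :: real)"
      by (intro summable_mult summable_geometric) simp
    have sFY: "summable (\<lambda>k. norm (F (Y k)))"
      by (rule summable_comparison_test'[OF sK, of 0]) (use FY in auto)
    then have "(\<lambda>k. F (\<Sum>i<k. Y i)) \<longlonglongrightarrow> (\<Sum>k. F (Y k))"
      using summable_LIMSEQ[OF summable_norm_cancel[OF sFY]] by (simp add: sum)
    ultimately have "F x = (\<Sum>k. F (Y k))"
      by (rule closed_graph)
    then have "norm (F x) \<le> (\<Sum>k. norm (F (Y k)))"
      using summable_norm[OF sFY] by simp
    also have "\<dots> \<le> (\<Sum>k. K * (1/2) ^ k)"
      by (rule suminf_le[OF FY sFY sK])
    also have "\<dots> = 2 * K"
      by (simp add: suminf_mult suminf_geometric summable_geometric)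
    finally show ?thesis .
  qed
  show ?thesis
  proof
    have "norm (F x) \<le> norm x * (2 * K)" for x
    proof (cases "x = 0")
      case True
      then show ?thesis by (simp add: zero)
    next
      case False
      have "F x = norm x *\<^sub>R F ((1 / norm x) *\<^sub>R x)"
        using False by (simp add: scale)
      moreover have "norm (F ((1 / norm x) *\<^sub>R x)) \<le> 2 * K"
        using False by (intro bound1) simp
      ultimately show ?thesis
        by (metis abs_norm_cancel mult_left_mono norm_ge_zero norm_scaleR)
    qed
    then show "\<exists>K. \<forall>x. norm (F x) \<le> norm x * K"
      by blast
  qed
qed

text \<open>Solving \<open>x - L x = y\<close> means finding the fixed point of
  \<open>\<lambda>x. y + L x\<close>. This takes the place of the Neumann series in all later
  perturbation arguments.\<close>

lemma bij_id_minus_contraction: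
  fixes L :: "'a::banach \<Rightarrow> 'a"
  assumes "linear L" and bound: "\<And>x. norm (L x) \<le> c * norm x" and "c < 1"
  shows "bij (\<lambda>x. x - L x)"
proof -
  interpret linear L by fact
  have *: "\<exists>!x. y + L x = x" for y
  proof (rule banach_fix_type)
    \<comment> \<open>\<open>c\<close> may be negative, while the fixed point theorem wants a
      nonnegative contraction constant.\<close>
    show "\<forall>x x'. dist (y + L x) (y + L x') \<le> max c 0 * dist x x'"
    proof (intro allI)
      fix x x'
      have "norm (L (x - x')) \<le> max c 0 * norm (x - x')"
        by (rule order_trans[OF bound]) (simp add: mult_right_mono)
      then show "dist (y + L x) (y + L x') \<le> max c 0 * dist x x'"
        by (simp add: dist_norm diff)
    qed
  qed (use \<open>c < 1\<close> in auto)
  then show ?thesis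
    unfolding bij_iff by (metis eq_diff_eq)
qed

section \<open>Gelfand theory\<close>

text \<open>The bound is what the resolvent identity yields when \<open>N c\<close> is the size of
  the resolvent at \<open>c\<close>. The unknown \<open>N c\<close> on its right-hand side must
  first be absorbed.\<close>

lemma continuous_if_resolvent_bound:
  fixes N :: "complex \<Rightarrow> real"
  assumes nonneg: "\<And>c. 0 \<le> N c"
    and bound: "\<And>c d. \<bar>N c - N d\<bar> \<le> cmod (c - d) * N c * N d"
  shows "continuous_on S N"
proof (rule continuous_at_imp_continuous_on, intro ballI)
  fix d
  \<comment> \<open>Chosen so that \<open>cmod (c - d) * N d \<le> 1 / 2\<close>, whence
    \<open>N c \<le> 2 * N d\<close>; the \<open>+ 1\<close> covers \<open>N d = 0\<close>.\<close>
  define \<delta> where "\<delta> = 1 / (2 * (N d + 1))"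
  have \<delta>: "\<delta> > 0"
    using nonneg[of d] by (simp add: \<delta>_def)
  have lip: "\<bar>N c - N d\<bar> \<le> cmod (c - d) * (2 * N d * N d)" if "cmod (c - d) < \<delta>" for c
  proof -
    have "cmod (c - d) * N d \<le> \<delta> * N d"
      using that nonneg by (intro mult_right_mono) auto
    also have "\<dots> \<le> 1 / 2"
      using nonneg[of d] by (simp add: \<delta>_def field_simps)
    finally have "(cmod (c - d) * N d) * N c \<le> (1 / 2) * N c"
      using nonneg by (intro mult_right_mono)
    then have "N c \<le> 2 * N d"
      using bound[of c d] by (simp add: mult_ac)
    then have "(cmod (c - d) * N d) * N c \<le> (cmod (c - d) * N d) * (2 * N d)"
      using nonneg by (intro mult_left_mono) auto
    then show ?thesis
      using bound[of c d] by (simp add: mult_ac)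
  qed
  have "((\<lambda>c. N c - N d) \<longlongrightarrow> 0) (at d)"
  proof (rule Lim_null_comparison)
    show "\<forall>\<^sub>F c in at d. norm (N c - N d) \<le> cmod (c - d) * (2 * N d * N d)"
      unfolding eventually_at using lip \<delta> by (auto simp: dist_norm)
    have "((\<lambda>c. cmod (c - d) * (2 * N d * N d)) \<longlongrightarrow> cmod (d - d) * (2 * N d * N d)) (at d)"
      by (intro tendsto_intros)
    then show "((\<lambda>c. cmod (c - d) * (2 * N d * N d)) \<longlongrightarrow> 0) (at d)"
      by simp
  qed
  then show "isCont N d"
    by (simp add: isCont_def LIM_zero_iff)
qed

text \<open>A geometric sum whose ratio is an \<open>n\<close>-th root of unity, different from
  \<open>1\<close> because \<open>0 < i < n\<close>. It removes the mixed terms when resolvents are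
  averaged over a circle.\<close>

lemma sum_root_unity_powers:
  assumes "0 < i" "i < n"
  shows "(\<Sum>k<n. exp (2 * of_real pi * \<i> * of_nat k / of_nat n) ^ i) = 0"
proof -
  define \<zeta> where "\<zeta> = exp (2 * of_real pi * \<i> * of_nat i / of_nat n)"
  have "n \<noteq> 0" "\<not> n dvd i"
    using assms by (auto dest: dvd_imp_le)
  then have "\<zeta> \<noteq> 1"
    using complex_root_unity_eq_1[of n i] by (simp add: \<zeta>_def)
  moreover have "\<zeta> ^ n = 1"
    using complex_root_unity[of n i] \<open>n \<noteq> 0\<close> by (simp add: \<zeta>_def)
  moreover have "exp (2 * of_real pi * \<i> * of_nat k / of_nat n) ^ i = \<zeta> ^ k" for k
    by (simp add: \<zeta>_def mult_ac flip: exp_of_nat_mult)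
  ultimately show ?thesis
    by (simp add: geometric_sum)
qed

section \<open>Complex scalars inside the algebra\<close>

locale complex_banach_algebra =
  fixes j :: "'a::{real_normed_algebra_1,comm_ring_1,banach}"
  assumes complex_structure: "complex_structure j"
begin

text \<open>The type class knows only real scalars. With complex scalars embedded as elements,
  scalar multiplication is ring multiplication and the ring laws apply to it.\<close>

definition emb :: "complex \<Rightarrow> 'a" where
  "emb c = of_real (Re c) + of_real (Im c) * j"

lemma cscale_eq: "cscale j c x = emb c * x"
  by (simp add: cscale_def emb_def)

lemma emb_0 [simp]: "emb 0 = 0"
  by (simp add: emb_def)

lemma emb_1 [simp]: "emb 1 = 1"
  by (simp add: emb_def)

lemma emb_of_real: "emb (of_real r) = of_real r"
  by (simp add: emb_def)

lemma emb_of_nat [simp]: "emb (of_nat n) = of_nat n"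
  using emb_of_real[of "real n"] by simp

lemma emb_add: "emb (c + d) = emb c + emb d"
  by (simp add: emb_def algebra_simps)

lemma emb_minus: "emb (- c) = - emb c"
  by (simp add: emb_def algebra_simps)

lemma emb_diff: "emb (c - d) = emb c - emb d"
  by (simp add: emb_def algebra_simps)

lemma emb_mult: "emb (c * d) = emb c * emb d"
proof -
  have jj: "j * (j * x) = - x" for x
    using complex_structure by (simp add: complex_structure_def flip: mult.assoc)
  have j2: "j * j = - 1"
    using complex_structure by (simp add: complex_structure_def)
  show ?thesis
    by (simp add: emb_def algebra_simps jj j2)
qed

lemma emb_power: "emb (c ^ n) = emb c ^ n"
  by (induction n) (auto simp: emb_mult)

lemma emb_sum: "emb (sum f I) = (\<Sum>i\<in>I. emb (f i))"
  by (induction I rule: infinite_finite_induct) (auto simp: emb_add)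

lemma norm_emb_mult: "norm (emb c * x) = cmod c * norm x"
  using complex_structure by (simp add: complex_structure_def cscale_eq)

lemma norm_emb: "norm (emb c) = cmod c"
  using norm_emb_mult[of c 1] by simp

lemma emb_inverse: "c \<noteq> 0 \<Longrightarrow> emb c * (emb (inverse c) * x) = x"
  by (simp flip: emb_mult mult.assoc)

lemma one_minus_invertible:
  fixes y :: 'a
  assumes "norm y < 1"
  shows "\<exists>z. (1 - y) * z = 1"
proof -
  have "bij (\<lambda>x. x - y * x)"
    by (rule bij_id_minus_contraction[where c = "norm y"])
      (use assms in \<open>auto intro: linearI simp: algebra_simps norm_mult_ineq\<close>)
  then obtain z where "z - y * z = 1"
    using bij_is_surj surjD[of "\<lambda>x. x - y * x" 1] by metis
  then show ?thesis
    by (intro exI[of _ z]) (simp add: algebra_simps)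
qed

end

section \<open>The quotient by a maximal ideal and the Gelfand-Mazur theorem\<close>

locale complex_banach_algebra_max_ideal = complex_banach_algebra +
  fixes M :: "'a set"
  assumes maximal: "maximal_ideal M"
begin

lemma M_zero: "0 \<in> M" and M_add: "a \<in> M \<Longrightarrow> b \<in> M \<Longrightarrow> a + b \<in> M"
  and M_mult: "b \<in> M \<Longrightarrow> a * b \<in> M"
  using maximal by (auto simp: maximal_ideal_def is_ideal_def)

lemma M_mult_right: "b \<in> M \<Longrightarrow> b * a \<in> M"
  using M_mult[of b a] by (simp add: mult.commute)

lemma M_minus: "a \<in> M \<Longrightarrow> - a \<in> M"
  using M_mult[of a "- 1"] by simp

lemma M_diff: "a \<in> M \<Longrightarrow> b \<in> M \<Longrightarrow> a - b \<in> M"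
  using M_add[of a "- b"] M_minus by simp

lemma M_sum: "(\<And>i. i \<in> I \<Longrightarrow> f i \<in> M) \<Longrightarrow> sum f I \<in> M"
  by (induction I rule: infinite_finite_induct) (auto intro: M_zero M_add)

lemma one_notin_M: "1 \<notin> M"
proof
  assume "1 \<in> M"
  then have "a \<in> M" for a
    using M_mult[of 1 a] by simp
  then show False
    using maximal by (auto simp: maximal_ideal_def)
qed

text \<open>Otherwise \<open>u = 1 - (1 - u)\<close> would be a unit in \<open>M\<close>. This is
  why the quotient seminorm does not vanish at \<open>1\<close>.\<close>

lemma norm_one_minus_M: "u \<in> M \<Longrightarrow> 1 \<le> norm (1 - u)"
  using one_minus_invertible[of "1 - u"] M_mult_right[of u] one_notin_M
  by (metis add_diff_cancel_left' add_diff_eq diff_add_cancel not_le_imp_less)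

text \<open>The ideal generated by \<open>M\<close> and \<open>x\<close> is larger than
  \<open>M\<close>, hence contains \<open>1\<close>: the quotient is a field.\<close>

lemma invertible_mod_M:
  assumes "x \<notin> M"
  shows "\<exists>y. x * y - 1 \<in> M"
proof -
  define J where "J = {u + a * x | u a. u \<in> M}"
  have "is_ideal J"
    unfolding is_ideal_def
  proof (intro conjI ballI allI)
    show "0 \<in> J"
      unfolding J_def using M_zero by clarsimp (metis add.right_neutral mult_zero_left)
  next
    fix b c assume "b \<in> J" "c \<in> J"
    then obtain u a u' a' where "b = u + a * x" "c = u' + a' * x" "u \<in> M" "u' \<in> M"
      by (auto simp: J_def)
    then have "b + c = (u + u') + (a + a') * x" "u + u' \<in> M"
      by (auto simp: algebra_simps M_add)
    then show "b + c \<in> J"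
      unfolding J_def by blast
  next
    fix a b assume "b \<in> J"
    then obtain u a' where "b = u + a' * x" "u \<in> M"
      by (auto simp: J_def)
    then have "a * b = a * u + (a * a') * x" "a * u \<in> M"
      by (auto simp: algebra_simps M_mult)
    then show "a * b \<in> J"
      unfolding J_def by blast
  qed
  moreover have "M \<subseteq> J"
    unfolding J_def by clarsimp (metis add.right_neutral mult_zero_left)
  moreover have "x \<in> J"
    unfolding J_def using M_zero by clarsimp (metis add.left_neutral mult_1)
  ultimately have "J = UNIV"
    using maximal assms by (auto simp: maximal_ideal_def)
  then have "1 \<in> J" by simp
  then obtain u a where "1 = u + a * x" "u \<in> M"
    by (auto simp: J_def)
  then have "x * a - 1 = - u"
    by (simp add: algebra_simps)
  then show ?thesis
    using M_minus[OF \<open>u \<in> M\<close>] by metis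
qed

text \<open>The quotient norm. The quotient is never formed as a type; an equation in it is stated
  as membership of a difference in \<open>M\<close> and enters estimates through
  \<open>q_cong\<close>.\<close>

definition q :: "'a \<Rightarrow> real" where
  "q x = infdist x M"

lemma q_nonneg: "0 \<le> q x"
  by (simp add: q_def infdist_nonneg)

lemma q_le: "u \<in> M \<Longrightarrow> q x \<le> norm (x - u)"
  by (metis q_def infdist_le dist_norm)

lemma q_le_norm: "q x \<le> norm x"
  using q_le[OF M_zero, of x] by simp

lemma q_approx:
  assumes "e > 0"
  obtains u where "u \<in> M" "norm (x - u) < q x + e"
proof -
  have "\<exists>u\<in>M. dist x u < q x + e"
  proof (rule ccontr)
    assume "\<not> ?thesis"
    then have "q x + e \<le> infdist x M"
      unfolding infdist_def using M_zero by (auto intro!: cINF_greatest)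
    then show False
      using assms by (simp add: q_def)
  qed
  then show ?thesis
    using that by (auto simp: dist_norm)
qed

lemma q_leI: "(\<And>e. e > 0 \<Longrightarrow> q x \<le> c + e) \<Longrightarrow> q x \<le> c"
  by (rule field_le_epsilon)

lemma q_add: "q (x + y) \<le> q x + q y"
proof (rule q_leI)
  fix e :: real assume "e > 0"
  obtain u where u: "u \<in> M" "norm (x - u) < q x + e / 2"
    using q_approx[of "e/2" x] \<open>e > 0\<close> by auto
  obtain v where v: "v \<in> M" "norm (y - v) < q y + e / 2"
    using q_approx[of "e/2" y] \<open>e > 0\<close> by auto
  have "q (x + y) \<le> norm (x + y - (u + v))"
    using u v by (intro q_le M_add)
  also have "\<dots> = norm ((x - u) + (y - v))"
    by (simp add: algebra_simps)
  also have "\<dots> \<le> norm (x - u) + norm (y - v)"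
    by (rule norm_triangle_ineq)
  finally show "q (x + y) \<le> q x + q y + e"
    using u v by simp
qed

lemma q_mult: "q (x * y) \<le> q x * q y"
proof -
  have *: "q (x * y) \<le> (q x + e) * (q y + e)" if e: "e > 0" for e
  proof -
    obtain u where u: "u \<in> M" "norm (x - u) < q x + e"
      using q_approx[OF e] by blast
    obtain v where v: "v \<in> M" "norm (y - v) < q y + e"
      using q_approx[OF e] by blast
    have "x * y - (x * v + (y - v) * u) = (x - u) * (y - v)"
      by (simp add: algebra_simps)
    moreover have "q (x * y) \<le> norm (x * y - (x * v + (y - v) * u))"
      using u v by (intro q_le M_add M_mult)
    ultimately have "q (x * y) \<le> norm (x - u) * norm (y - v)"
      using norm_mult_ineq[of "x - u" "y - v"] by simp
    also have "\<dots> \<le> (q x + e) * (q y + e)"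
      using u v q_nonneg[of x] that by (intro mult_mono) auto
    finally show ?thesis .
  qed
  have "((\<lambda>e. (q x + e) * (q y + e)) \<longlongrightarrow> (q x + 0) * (q y + 0)) (at_right 0)"
    by (intro tendsto_intros)
  moreover have "\<forall>\<^sub>F e in at_right 0. q (x * y) \<le> (q x + e) * (q y + e)"
    using * by (auto simp: eventually_at_right_less intro: eventually_at_rightI[of 0 1])
  ultimately show ?thesis
    using tendsto_lowerbound[of "\<lambda>e. (q x + e) * (q y + e)" _ "at_right 0"] by simp
qed

lemma q_cong: "x - y \<in> M \<Longrightarrow> q x = q y"
proof -
  have "q x \<le> q y" if "x - y \<in> M" for x y
  proof (rule q_leI)
    fix e :: real assume "e > 0"
    then obtain u where u: "u \<in> M" "norm (y - u) < q y + e"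
      using q_approx by blast
    have "q x \<le> norm (x - ((x - y) + u))"
      using u that by (intro q_le M_add)
    then show "q x \<le> q y + e"
      using u by simp
  qed
  then show "x - y \<in> M \<Longrightarrow> q x = q y"
    using M_minus[of "x - y"] by (auto intro!: antisym)
qed

lemma q_one: "q 1 = 1"
proof (rule antisym)
  show "q 1 \<le> 1"
    using q_le_norm[of 1] by simp
  show "1 \<le> q 1"
  proof (rule field_le_epsilon)
    fix e :: real assume "e > 0"
    then obtain u where "u \<in> M" "norm (1 - u) < q 1 + e"
      using q_approx by blast
    then show "1 \<le> q 1 + e"
      using norm_one_minus_M[of u] by simp
  qed
qed

lemma q_emb_le: "q (emb c * x) \<le> cmod c * q x"
  using q_mult[of "emb c" x] q_le_norm[of "emb c"] mult_right_mono[OF _ q_nonneg]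
  by (metis norm_emb order_trans)

lemma q_emb: "q (emb c * x) = cmod c * q x"
proof (cases "c = 0")
  case True
  then show ?thesis
    using q_nonneg[of 0] q_le_norm[of 0] by simp
next
  case False
  have "q x \<le> cmod (inverse c) * q (emb c * x)"
    using q_emb_le[of "inverse c" "emb c * x"] False by (simp flip: emb_mult mult.assoc)
  then have "cmod c * q x \<le> q (emb c * x)"
    using False by (simp add: norm_inverse pos_le_divide_eq mult.commute flip: divide_inverse_commute)
  then show ?thesis
    using q_emb_le[of c x] by simp
qed

lemma q_minus: "q (- x) = q x"
  using q_emb[of "- 1" x] by (simp add: emb_minus)

lemma q_diff: "q (x - y) \<le> q x + q y"
  using q_add[of x "- y"] by (simp add: q_minus)

lemma q_sum: "q (sum f I) \<le> (\<Sum>i\<in>I. q (f i))"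
proof (induction I rule: infinite_finite_induct)
  case (insert i I)
  then show ?case
    using q_add[of "f i" "sum f I"] by simp
qed (use q_le_norm[of 0] in auto)

lemma q_power: "q (x ^ n) \<le> q x ^ n"
proof (induction n)
  case (Suc n)
  have "q (x ^ Suc n) \<le> q x * q (x ^ n)"
    using q_mult[of x "x ^ n"] by simp
  also have "\<dots> \<le> q x * q x ^ n"
    using Suc q_nonneg by (intro mult_left_mono) auto
  finally show ?case by simp
qed (simp add: q_one)

lemma power_mod_M:
  assumes "a - b \<in> M"
  shows "a ^ n - b ^ n \<in> M"
proof (induction n)
  case (Suc n)
  have "a ^ Suc n - b ^ Suc n = a * (a ^ n - b ^ n) + b ^ n * (a - b)"
    by (simp add: algebra_simps)
  then show ?case
    using Suc assms by (auto intro: M_add M_mult)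
qed (simp add: M_zero)

text \<open>A version of Rickart's elementary proof of the Gelfand--Mazur theorem, carried out modulo
  the ideal: averaging \<open>c (c - x)\<inverse>\<close> over the \<open>n\<close>-th roots of \<open>r ^ n\<close> gives
  \<open>r ^ n (r ^ n - x ^ n)\<inverse>\<close>, so that uniform continuity of the former in \<open>c\<close> shows that the
  set of \<open>r > 0\<close> with \<open>q (x ^ n) < r ^ n\<close> for some \<open>n\<close> reaches down to \<open>0\<close>.\<close>

proposition Gelfand_Mazur: "\<exists>c. x - emb c \<in> M"
proof (rule ccontr)
  assume "\<not> ?thesis"
  then have "\<forall>c. \<exists>y. (x - emb c) * y - 1 \<in> M"
    using invertible_mod_M by blast
  then obtain y where y: "\<And>c. (x - emb c) * y c - 1 \<in> M"
    by metis
  have resolvent: "(y c - y d) - emb (c - d) * (y c * y d) \<in> M" for c d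
  proof -
    have "(y c - y d) - emb (c - d) * (y c * y d)
        = y d * ((x - emb c) * y c - 1) - y c * ((x - emb d) * y d - 1)"
      by (simp add: algebra_simps emb_diff)
    then show ?thesis
      using y by (auto intro: M_diff M_mult)
  qed
  have y_diff: "q (y c - y d) \<le> cmod (c - d) * q (y c) * q (y d)" for c d
    unfolding q_cong[OF resolvent]
    using q_emb[of "c - d" "y c * y d"] mult_left_mono[OF q_mult, of "cmod (c - d)" "y c" "y d"]
    by (simp add: mult_ac)
  have "continuous_on S (\<lambda>c. q (y c))" for S
  proof (rule continuous_if_resolvent_bound)
    fix c d
    have "q (y c) \<le> q (y d) + q (y c - y d)" "q (y d) \<le> q (y c) + q (y c - y d)"
      using q_add[of "y d" "y c - y d"] q_diff[of "y c" "y c - y d"] by auto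
    then show "\<bar>q (y c) - q (y d)\<bar> \<le> cmod (c - d) * q (y c) * q (y d)"
      using y_diff[of c d] by simp
  qed (rule q_nonneg)
  \<comment> \<open>\<open>y c\<close> inverts \<open>x - c\<close>, whence the sign:
    \<open>h c\<close> represents \<open>c (c - x)\<inverse>\<close> modulo
    \<open>M\<close>.\<close>
  define h where "h c = - emb c * y c" for c
  \<comment> \<open>The factor \<open>c - x\<close> of \<open>c ^ n - x ^ n\<close> cancels against
    the one in \<open>h c\<close>; \<open>c\<close> times the other factor is the sum.\<close>
  have h_mod: "h c * (emb (c ^ n) - x ^ n) - (\<Sum>i<n. emb (c ^ (n - i)) * x ^ i) \<in> M" for c n
  proof -
    define T where "T = (\<Sum>i<n. emb c ^ (n - Suc i) * x ^ i)"
    have "x ^ n - emb c ^ n = (x - emb c) * T"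
      unfolding T_def by (rule power_diff_sumr2)
    moreover have "h c * (emb (c ^ n) - x ^ n) = emb c * y c * (x ^ n - emb c ^ n)"
      by (simp add: h_def emb_power algebra_simps)
    moreover have "(\<Sum>i<n. emb (c ^ (n - i)) * x ^ i) = emb c * T"
      unfolding sum_distrib_left T_def
    proof (rule sum.cong)
      fix i assume "i \<in> {..<n}"
      then have "n - i = Suc (n - Suc i)"
        by auto
      then show "emb (c ^ (n - i)) * x ^ i = emb c * (emb c ^ (n - Suc i) * x ^ i)"
        by (simp add: emb_power emb_mult mult_ac)
    qed simp
    ultimately have "h c * (emb (c ^ n) - x ^ n) - (\<Sum>i<n. emb (c ^ (n - i)) * x ^ i)
      = (emb c * T) * ((x - emb c) * y c - 1)"
      by (simp add: right_diff_distrib mult_ac)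
    then show ?thesis
      using M_mult[OF y] by simp
  qed
  define pt where "pt r n k = of_real r * exp (2 * of_real pi * \<i> * of_nat k / of_nat n)" for r n k
  define avg where "avg r n = emb (1 / of_nat n) * (\<Sum>k<n. h (pt r n k))" for r n
  have avg_mod: "avg r n * (emb (of_real r ^ n) - x ^ n) - emb (of_real r ^ n) \<in> M" if "n > 0" for r n
  proof -
    have pt_n: "pt r n k ^ n = of_real r ^ n" for k
      using complex_root_unity[of n k] that by (simp add: pt_def power_mult_distrib)
    \<comment> \<open>Only \<open>i = 0\<close> survives the averaging: there the exponent is the
      full \<open>n\<close>, and otherwise it lies strictly between \<open>0\<close> and
      \<open>n\<close>.\<close>
    have pt_sum: "(\<Sum>k<n. pt r n k ^ (n - i)) = (if i = 0 then of_nat n * of_real r ^ n else 0)" if "i < n" for i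
    proof (cases "i = 0")
      case True
      then show ?thesis by (simp add: pt_n)
    next
      case False
      then show ?thesis
        using sum_root_unity_powers[of "n - i" n] that
        by (simp add: pt_def power_mult_distrib flip: sum_distrib_left)
    qed
    have "(\<Sum>k<n. h (pt r n k) * (emb (pt r n k ^ n) - x ^ n)
        - (\<Sum>i<n. emb (pt r n k ^ (n - i)) * x ^ i)) \<in> M"
      by (intro M_sum h_mod)
    also have "(\<Sum>k<n. h (pt r n k) * (emb (pt r n k ^ n) - x ^ n)
        - (\<Sum>i<n. emb (pt r n k ^ (n - i)) * x ^ i))
      = (\<Sum>k<n. h (pt r n k)) * (emb (of_real r ^ n) - x ^ n)
        - (\<Sum>i<n. emb (\<Sum>k<n. pt r n k ^ (n - i)) * x ^ i)"
      unfolding sum_subtractf pt_n emb_sum sum_distrib_right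
      by (subst sum.swap[of _ "{..<n}"]) simp
    also have "(\<Sum>i<n. emb (\<Sum>k<n. pt r n k ^ (n - i)) * x ^ i)
        = (\<Sum>i<n. if i = 0 then emb (of_nat n * of_real r ^ n) else 0)"
      by (rule sum.cong) (auto simp: pt_sum)
    also have "\<dots> = emb (of_nat n * of_real r ^ n)"
      using that by simp
    finally have "emb (1 / of_nat n) * ((\<Sum>k<n. h (pt r n k)) * (emb (of_real r ^ n) - x ^ n)
        - emb (of_nat n * of_real r ^ n)) \<in> M"
      by (rule M_mult)
    also have "emb (1 / of_nat n) * ((\<Sum>k<n. h (pt r n k)) * (emb (of_real r ^ n) - x ^ n)
        - emb (of_nat n * of_real r ^ n))
      = avg r n * (emb (of_real r ^ n) - x ^ n) - emb (1 / of_nat n * (of_nat n * of_real r ^ n))"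
      by (simp add: avg_def right_diff_distrib mult.assoc emb_mult[of "1 / of_nat n"] del: times_divide_eq_left)
    also have "1 / of_nat n * (of_nat n * of_real r ^ n) = (of_real r ^ n :: complex)"
      using that by simp
    finally show ?thesis .
  qed
  \<comment> \<open>The average represents \<open>r ^ n (r ^ n - x ^ n)\<inverse>\<close>, so it is
    near \<open>1\<close> when \<open>q (x ^ n)\<close> is small against \<open>r ^ n\<close>, and
    conversely. The first direction is applied at a radius \<open>s\<close>, the second at a smaller
    radius \<open>r\<close>.\<close>
  have avg_bound: "r ^ n * q (avg r n - 1) \<le> q (avg r n) * q (x ^ n)"
    "q (x ^ n) \<le> r ^ n * q (avg r n - 1) + q (avg r n - 1) * q (x ^ n)"
    if "n > 0" "r > 0" for r n
  proof -
    have "emb (of_real r ^ n) * (avg r n - 1) - avg r n * x ^ n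
        = avg r n * (emb (of_real r ^ n) - x ^ n) - emb (of_real r ^ n)"
      by (simp add: algebra_simps)
    then have eq: "q (emb (of_real r ^ n) * (avg r n - 1)) = q (avg r n * x ^ n)"
      using avg_mod[OF that(1), of r] by (intro q_cong) simp
    have eq': "q (emb (of_real r ^ n) * (avg r n - 1)) = r ^ n * q (avg r n - 1)"
      using that by (simp add: q_emb norm_power)
    show "r ^ n * q (avg r n - 1) \<le> q (avg r n) * q (x ^ n)"
      using eq eq' q_mult[of "avg r n" "x ^ n"] by simp
    have "x ^ n = avg r n * x ^ n - (avg r n - 1) * x ^ n"
      by (simp add: algebra_simps)
    then have "q (x ^ n) \<le> q (avg r n * x ^ n) + q ((avg r n - 1) * x ^ n)"
      using q_diff by metis
    then show "q (x ^ n) \<le> r ^ n * q (avg r n - 1) + q (avg r n - 1) * q (x ^ n)"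
      using eq eq' q_mult[of "avg r n - 1" "x ^ n"] by simp
  qed
  \<comment> \<open>\<open>Inf E\<close> is the infimum of the \<open>n\<close>-th roots of
    \<open>q (x ^ n)\<close>, the spectral radius of \<open>x\<close> modulo \<open>M\<close>. It
    will turn out to be \<open>0\<close>, which an element invertible modulo \<open>M\<close> cannot
    have.\<close>
  define E where "E = {r. r > 0 \<and> (\<exists>n>0. q (x ^ n) < r ^ n)}"
  have E_up: "s \<in> E" if "r \<in> E" "r \<le> s" for r s
    using that by (auto simp: E_def) (meson less_le_trans less_imp_le power_mono)
  have E_small: "\<exists>n>0. q (x ^ n) \<le> e * r ^ n" if "r \<in> E" "e > 0" for r e
  proof -
    obtain n where n: "n > 0" "q (x ^ n) < r ^ n" and "r > 0"
      using \<open>r \<in> E\<close> by (auto simp: E_def)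
    define \<theta> where "\<theta> = q (x ^ n) / r ^ n"
    have "0 \<le> \<theta>" "\<theta> < 1"
      using n \<open>r > 0\<close> q_nonneg[of "x ^ n"] by (auto simp: \<theta>_def)
    then obtain k where k: "\<theta> ^ k < e"
      using real_arch_pow_inv[OF \<open>e > 0\<close>] by blast
    have "\<theta> ^ Suc k \<le> e"
      using k \<open>0 \<le> \<theta>\<close> \<open>\<theta> < 1\<close> power_decreasing[of k "Suc k" \<theta>] by simp
    moreover have "q (x ^ (n * Suc k)) \<le> q (x ^ n) ^ Suc k"
      using q_power[of "x ^ n" "Suc k"] by (simp only: power_mult)
    moreover have "q (x ^ n) ^ Suc k = \<theta> ^ Suc k * r ^ (n * Suc k)"
      using \<open>r > 0\<close> by (simp only: \<theta>_def power_mult power_divide) simp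
    ultimately have "q (x ^ (n * Suc k)) \<le> e * r ^ (n * Suc k)"
      using \<open>r > 0\<close> by (metis mult_right_mono order_trans zero_le_power less_imp_le)
    moreover have "n * Suc k > 0"
      using n by simp
    ultimately show ?thesis
      by blast
  qed
  have E_closed: "r \<in> E" if "r > 0" and above: "\<And>s. s > r \<Longrightarrow> s \<in> E" for r
  proof -
    have "bounded ((\<lambda>c. q (y c)) ` cball 0 (r + 1))"
      by (intro compact_imp_bounded compact_continuous_image compact_cball) fact
    then obtain B where B: "B > 0" "\<And>c. cmod c \<le> r + 1 \<Longrightarrow> q (y c) \<le> B"
      by (force simp: bounded_pos)
    have h_diff: "q (h c - h d) \<le> cmod (c - d) * (B + (r + 1) * B * B)"
      if "cmod c \<le> r + 1" "cmod d \<le> r + 1" for c d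
    proof -
      have "h c - h d = - (emb (c - d) * y c + emb d * (y c - y d))"
        by (simp add: h_def emb_diff algebra_simps)
      then have "q (h c - h d) \<le> cmod (c - d) * q (y c) + cmod d * q (y c - y d)"
        using q_add[of "emb (c - d) * y c" "emb d * (y c - y d)"]        by (simp add: q_minus q_emb del: minus_add_distrib)
      also have "\<dots> \<le> cmod (c - d) * B + (r + 1) * (cmod (c - d) * B * B)"
      proof (intro add_mono mult_mono)
        show "q (y c - y d) \<le> cmod (c - d) * B * B"
          using y_diff[of c d] B(2)[OF that(1)] B(2)[OF that(2)] B(1) q_nonneg
          by (smt (verit) mult_left_mono mult_mono norm_ge_zero zero_le_mult_iff)
      qed (use that B q_nonneg \<open>r > 0\<close> in auto)
      finally show ?thesis
        by (simp add: algebra_simps)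
    qed
    define L where "L = B + (r + 1) * B * B"
    have "L > 0"
      using B \<open>r > 0\<close> by (simp add: L_def add_pos_pos)
    \<comment> \<open>\<open>L\<close> is a Lipschitz constant of \<open>h\<close> on the disc of
      radius \<open>r + 1\<close>. Passing from \<open>s\<close> to \<open>r\<close> changes every
      average by at most \<open>1 / 8\<close>, whatever \<open>n\<close> is; hence \<open>n\<close>
      may be chosen afterwards, to suit \<open>s\<close>.\<close>
    define s where "s = r + min 1 (1 / (8 * L))"
    have s: "r < s" "s \<le> r + 1" "(s - r) * L \<le> 1 / 8"
      using \<open>L > 0\<close> by (auto simp: s_def min_def field_simps)
    obtain n where n: "n > 0" "q (x ^ n) \<le> (1 / 8) * s ^ n"
      using E_small[OF above[OF s(1)], of "1/8"] by auto
    define b where "b = q (avg r n - 1)"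
    define a where "a = q (avg s n - 1)"
    have "b \<le> a + 1 / 8"
    proof -
      have pt_norm: "cmod (pt t n k) = \<bar>t\<bar>" for t k
        by (simp add: pt_def norm_mult)
      have "pt r n k - pt s n k = of_real (r - s) * exp (2 * of_real pi * \<i> * of_nat k / of_nat n)" for k
        by (simp add: pt_def algebra_simps)
      then have pt_diff: "cmod (pt r n k - pt s n k) = s - r" for k
        using s by (simp add: norm_mult del: of_real_diff)
      have "avg r n - avg s n = emb (1 / of_nat n) * (\<Sum>k<n. h (pt r n k) - h (pt s n k))"
        by (simp add: avg_def sum_subtractf algebra_simps)
      then have "q (avg r n - avg s n) = (1 / n) * q (\<Sum>k<n. h (pt r n k) - h (pt s n k))"
        by (simp add: q_emb norm_divide)
      also have "\<dots> \<le> (1 / n) * (\<Sum>k<n. q (h (pt r n k) - h (pt s n k)))"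
        by (intro mult_left_mono q_sum) auto
      also have "\<dots> \<le> (1 / n) * (\<Sum>k<n. 1 / 8)"
      proof (intro mult_left_mono sum_mono)
        fix k
        have "q (h (pt r n k) - h (pt s n k)) \<le> (s - r) * L"
          using h_diff[of "pt r n k" "pt s n k"] s \<open>r > 0\<close> by (simp add: pt_norm pt_diff L_def)
        then show "q (h (pt r n k) - h (pt s n k)) \<le> 1 / 8"
          using s by simp
      qed simp
      also have "\<dots> = 1 / 8"
        using n by simp
      finally have "q (avg r n - avg s n) \<le> 1 / 8" .
      then show ?thesis
        using q_add[of "avg r n - avg s n" "avg s n - 1"] by (simp add: a_def b_def)
    qed
    moreover have "a \<le> 1 / 7"
    proof -
      have "s ^ n * a \<le> q (avg s n) * q (x ^ n)"
        using avg_bound(1)[OF n(1), of s] s \<open>r > 0\<close> by (simp add: a_def)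
      also have "\<dots> \<le> (a + 1) * ((1 / 8) * s ^ n)"
        using q_add[of "avg s n - 1" 1] n q_nonneg[of "avg s n - 1"]
        by (intro mult_mono) (auto simp: a_def q_one q_nonneg)
      finally have "s ^ n * a \<le> s ^ n * ((a + 1) / 8)"
        by (simp add: algebra_simps)
      moreover have "s ^ n > 0"
        using s \<open>r > 0\<close> by simp
      ultimately have "a \<le> (a + 1) / 8"
        by (metis mult_le_cancel_left_pos)
      then show ?thesis
        by simp
    qed
    \<comment> \<open>\<open>1 / 7 + 1 / 8 < 1 / 3\<close>, and with a third the second bound
      becomes \<open>q (x ^ n) \<le> r ^ n / 2\<close>.\<close>
    ultimately have b: "b \<le> 1 / 3"
      by simp
    have "q (x ^ n) \<le> r ^ n * b + b * q (x ^ n)"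
      using avg_bound(2)[OF n(1) \<open>r > 0\<close>] by (simp add: b_def)
    also have "\<dots> \<le> r ^ n * (1 / 3) + (1 / 3) * q (x ^ n)"
      using b \<open>r > 0\<close> q_nonneg by (intro add_mono mult_left_mono mult_right_mono) auto
    finally have "q (x ^ n) \<le> r ^ n / 2"
      by simp
    moreover have "r ^ n > 0"
      using \<open>r > 0\<close> by simp
    ultimately have "q (x ^ n) < r ^ n"
      by linarith
    then show ?thesis
      using n \<open>r > 0\<close> by (auto simp: E_def)
  qed
  have E_open: "\<exists>s<r. s \<in> E" if r: "r \<in> E" for r
  proof -
    obtain n where n: "n > 0" "q (x ^ n) < r ^ n" and "r > 0"
      using r by (auto simp: E_def)
    define t where "t = root n (q (x ^ n))"
    have t: "t \<ge> 0" "t ^ n = q (x ^ n)"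
      using n q_nonneg by (auto simp: t_def)
    then have "t < r"
      using n \<open>r > 0\<close> by (metis less_imp_le power_less_imp_less_base)
    define s where "s = (t + r) / 2"
    have "t < s" "s < r" "s > 0"
      using t \<open>t < r\<close> \<open>r > 0\<close> by (auto simp: s_def)
    then have "q (x ^ n) < s ^ n"
      using t n power_strict_mono[of t s n] by simp
    then show ?thesis
      using n \<open>s < r\<close> \<open>s > 0\<close> by (auto simp: E_def)
  qed
  have "norm x + 1 \<in> E"
    using q_le_norm[of x] by (auto simp: E_def intro!: exI[of _ 1] add_nonneg_pos)
  then have ne: "E \<noteq> {}" by blast
  have bdd: "bdd_below E"
    by (auto simp: E_def intro!: bdd_belowI[of _ 0])
  have above_Inf: "s \<in> E" if "s > Inf E" for s
    using that cInf_less_iff[OF ne bdd] E_up by (meson less_imp_le)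
  have "Inf E \<le> 0"
  proof (rule ccontr)
    assume "\<not> Inf E \<le> 0"
    then have "Inf E \<in> E"
      using E_closed above_Inf by simp
    then show False
      using E_open cInf_lower[OF _ bdd] by (metis not_less)
  qed
  \<comment> \<open>As \<open>x * y 0\<close> is \<open>1\<close> modulo \<open>M\<close>, the
    powers of \<open>x\<close> cannot decay faster than those of \<open>1 / q (y 0)\<close>; the
    \<open>+ 1\<close> puts \<open>r\<close> strictly below.\<close>
  define r where "r = 1 / (q (y 0) + 1)"
  have "r > 0"
    using q_nonneg[of "y 0"] by (simp add: r_def)
  then have "r \<in> E"
    using above_Inf \<open>Inf E \<le> 0\<close> by simp
  then obtain n where n: "n > 0" "q (x ^ n) < r ^ n"
    by (auto simp: E_def)
  have "(x * y 0) ^ n - 1 ^ n \<in> M"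
    using y[of 0] by (intro power_mod_M) simp
  then have "1 = q (x ^ n * y 0 ^ n)"
    using q_cong[of "(x * y 0) ^ n" 1] by (simp add: q_one power_mult_distrib)
  also have "\<dots> \<le> q (x ^ n) * q (y 0 ^ n)"
    by (rule q_mult)
  also have "\<dots> \<le> r ^ n * q (y 0) ^ n"
    using n q_power[of "y 0" n] q_nonneg \<open>r > 0\<close> by (intro mult_mono) auto
  also have "\<dots> = (q (y 0) / (q (y 0) + 1)) ^ n"
    by (simp add: r_def power_divide)
  also have "\<dots> < 1"
    using n q_nonneg[of "y 0"] power_strict_mono[of "q (y 0) / (q (y 0) + 1)" 1 n] by simp
  finally show False by simp
qed

end

section \<open>Characters and their topology\<close>

context complex_banach_algebra
begin

abbreviation chars :: "('a \<Rightarrow> complex) set" where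
  "chars \<equiv> max_ideal_space j"

abbreviation shilov :: "('a \<Rightarrow> complex) set" where
  "shilov \<equiv> shilov_boundary j"

lemma
  assumes "m \<in> chars"
  shows char_add: "m (x + y) = m x + m y"
    and char_mult: "m (x * y) = m x * m y"
    and char_emb_mult: "m (emb c * x) = c * m x"
    and char_1: "m 1 = 1"
    and char_emb: "m (emb c) = c"
    and char_diff: "m (x - y) = m x - m y"
    and char_power: "m (x ^ n) = m x ^ n"
proof -
  show add: "m (x + y) = m x + m y" for x y
    using assms by (simp add: max_ideal_space_def)
  show mult: "m (x * y) = m x * m y" for x y
    using assms by (simp add: max_ideal_space_def)
  show emb: "m (emb c * x) = c * m x" for c x
    using assms unfolding max_ideal_space_def cscale_eq by blast
  show one: "m 1 = 1"
    using assms by (simp add: max_ideal_space_def)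
  show "m (emb c) = c"
    using emb[of c 1] one by simp
  have minus: "m (- x) = - m x" for x
    using emb[of "- 1" x] by (simp add: emb_minus)
  show "m (x - y) = m x - m y"
    using add[of x "- y"] minus by simp
  show "m (x ^ n) = m x ^ n"
    by (induction n) (auto simp: one mult)
qed

text \<open>Continuity is not part of the definition of a character but automatic: if
  \<open>norm x < cmod (m x)\<close>, then \<open>1 - x / m x\<close> is a unit annihilated by
  \<open>m\<close>.\<close>

lemma char_le_norm:
  assumes m: "m \<in> chars"
  shows "cmod (m x) \<le> norm x"
proof (rule ccontr)
  assume less: "\<not> ?thesis"
  then have "m x \<noteq> 0"
    by auto
  define y where "y = emb (inverse (m x)) * x"
  have "norm y < 1"
    using less \<open>m x \<noteq> 0\<close>
    by (simp add: y_def norm_emb_mult norm_inverse divide_less_eq flip: divide_inverse_commute)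
  then obtain z where z: "(1 - y) * z = 1"
    using one_minus_invertible by blast
  have "m (1 - y) = 0"
    using \<open>m x \<noteq> 0\<close> by (simp add: y_def char_diff[OF m] char_1[OF m] char_emb_mult[OF m])
  then have "m ((1 - y) * z) = 0"
    by (simp add: char_mult[OF m])
  then show False
    by (simp add: z char_1[OF m])
qed

lemma bounded_linear_char:
  assumes m: "m \<in> chars"
  shows "bounded_linear m"
proof (rule bounded_linear_intro[where K = 1])
  show "m (r *\<^sub>R x) = r *\<^sub>R m x" for r x
    using char_emb_mult[OF m, of "of_real r" x] by (simp add: emb_of_real scaleR_conv_of_real)
qed (use char_le_norm[OF m] in \<open>auto simp: char_add[OF m]\<close>)

text \<open>By Gelfand-Mazur each element is congruent modulo \<open>I\<close> to exactly one
  scalar, and sending it there is a character with kernel \<open>I\<close>. This leads from the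
  algebraic notion of semisimplicity to characters.\<close>

lemma char_separating_max_ideal:
  assumes "maximal_ideal I" "x \<notin> I"
  shows "\<exists>m\<in>chars. m x \<noteq> 0"
proof -
  interpret complex_banach_algebra_max_ideal j I
    by unfold_locales fact
  define m where "m x = (SOME c. x - emb c \<in> I)" for x
  have m: "x - emb (m x) \<in> I" for x
    unfolding m_def by (rule someI_ex) (rule Gelfand_Mazur)
  have m_eq: "m x = c" if "x - emb c \<in> I" for x c
  proof (rule ccontr)
    assume "m x \<noteq> c"
    have "emb (m x - c) \<in> I"
      using M_diff[OF that m[of x]] by (simp add: emb_diff)
    then have "emb (inverse (m x - c)) * emb (m x - c) \<in> I"
      by (rule M_mult)
    then show False
      using one_notin_M \<open>m x \<noteq> c\<close> by (simp flip: emb_mult)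
  qed
  have "m \<in> chars"
    unfolding max_ideal_space_def
  proof (intro CollectI conjI allI)
    show "m (x + y) = m x + m y" for x y
      using M_add[OF m[of x] m[of y]] by (intro m_eq) (simp add: emb_add algebra_simps)
    show "m (x * y) = m x * m y" for x y
    proof (rule m_eq)
      have "x * y - emb (m x * m y) = x * (y - emb (m y)) + emb (m y) * (x - emb (m x))"
        by (simp add: emb_mult algebra_simps)
      then show "x * y - emb (m x * m y) \<in> I"
        using m by (auto intro: M_add M_mult)
    qed
    show "m (cscale j c x) = c * m x" for c x
      using M_mult[OF m, of "emb c" x] by (intro m_eq) (simp add: cscale_eq emb_mult algebra_simps)
    show "m 1 = 1"
      by (rule m_eq) (simp add: M_zero)
  qed
  moreover have "m x \<noteq> 0"
    using m[of x] assms by (metis diff_zero emb_0)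
  ultimately show ?thesis
    by blast
qed

lemma closed_chars: "closed chars"
proof -
  have cont: "continuous_on UNIV (\<lambda>m::'a \<Rightarrow> complex. m x)" for x
    by simp
  show ?thesis
    unfolding max_ideal_space_def
    by (intro closed_Collect_conj closed_Collect_all closed_Collect_eq continuous_intros cont)
qed

text \<open>Tychonoff: by \<open>char_le_norm\<close> the characters form a closed subset of a
  product of discs of radius \<open>norm x\<close>.\<close>

lemma compact_chars: "compact chars"
proof -
  have "compactin (product_topology (\<lambda>x. euclidean) UNIV) (PiE UNIV (\<lambda>x::'a. cball (0::complex) (norm x)))"
    unfolding compactin_PiE by simp
  then have "compact (PiE UNIV (\<lambda>x::'a. cball (0::complex) (norm x)))"
    by (simp add: euclidean_product_topology)
  moreover have "chars \<subseteq> PiE UNIV (\<lambda>x::'a. cball 0 (norm x))"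
    using char_le_norm by (auto simp: PiE_iff)
  ultimately show ?thesis
    using closed_chars compact_Int_closed[of _ chars] by (metis inf.absorb2)
qed

lemma closedin_chars_iff: "closedin (top_of_set chars) B \<longleftrightarrow> closed B \<and> B \<subseteq> chars"
  using closed_chars by (rule closedin_closed_eq)

lemma boundary_max:
  assumes "is_boundary j B"
  obtains b where "b \<in> B" "\<And>m. m \<in> chars \<Longrightarrow> cmod (m f) \<le> cmod (b f)"
  using assms unfolding is_boundary_def by blast

lemma boundary_subset: "is_boundary j B \<Longrightarrow> B \<subseteq> chars"
  by (simp add: is_boundary_def)

section \<open>The Shilov boundary\<close>

text \<open>Centre and radius are absorbed into the elements: \<open>cmod (m' i - m i) < e\<close>
  says that the modulus of \<open>m'\<close> at \<open>(i - m i) / e\<close> is below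
  \<open>1\<close>. This form suits multiplicative estimates.\<close>

definition basic_nbhd :: "'a set \<Rightarrow> ('a \<Rightarrow> complex) set" where
  "basic_nbhd F = {m. \<forall>f\<in>F. cmod (m f) < 1}"

lemma open_basic_nbhd:
  assumes "finite F"
  shows "open (basic_nbhd F)"
proof -
  have "open {m::'a \<Rightarrow> complex. cmod (m f) < 1}" for f
    by (intro open_Collect_less continuous_intros) simp
  then show ?thesis
    unfolding basic_nbhd_def using assms open_INT[of F "\<lambda>f. {m. cmod (m f) < 1}"]
    by (simp add: Collect_ball_eq)
qed

text \<open>This dichotomy for basic neighbourhoods is the key to H. S. Bear's proof of the existence
  of the Shilov boundary.\<close>

lemma boundary_minus_basic_nbhd:
  assumes F: "finite F" and B: "is_boundary j B" "B \<inter> basic_nbhd F = {}"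
    and E: "is_boundary j E" "closed E"
  shows "is_boundary j (E - basic_nbhd F)"
proof (rule ccontr)
  let ?V = "basic_nbhd F"
  assume "\<not> is_boundary j (E - ?V)"
  then obtain f0 where f0: "\<forall>m\<in>E - ?V. \<exists>m'\<in>chars. cmod (m f0) < cmod (m' f0)"
    using E by (auto simp: is_boundary_def not_le)
  have "\<exists>f. \<exists>e\<in>E. cmod (e f) > 0 \<and> (\<forall>m\<in>E - ?V. cmod (m f) < cmod (e f)) \<and>
      (\<forall>m\<in>chars. cmod (m f) \<le> cmod (e f))"
  proof -
    obtain e where e: "e \<in> E" "\<And>m. m \<in> chars \<Longrightarrow> cmod (m f0) \<le> cmod (e f0)"
      using boundary_max[OF E(1)] by blast
    have less: "cmod (m f0) < cmod (e f0)" if "m \<in> E - ?V" for m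
      using bspec[OF f0 that] e(2) by force
    show ?thesis
    proof (cases "cmod (e f0) > 0")
      case True
      then show ?thesis
        using e less by blast
    next
      case False
      \<comment> \<open>Nothing can lie strictly below a maximum modulus of \<open>0\<close>. With
        \<open>E - ?V\<close> empty, the constant \<open>1\<close> serves in place of
        \<open>f0\<close>.\<close>
      then have "E - ?V = {}"
        using less by fastforce
      moreover have "e 1 = 1" "\<forall>m\<in>chars. m 1 = 1"
        using e boundary_subset[OF E(1)] by (auto intro: char_1)
      ultimately show ?thesis
        using e(1) by (intro exI[of _ 1] bexI[of _ e]) auto
    qed
  qed
  then obtain f1 e where e: "e \<in> E" "e f1 \<noteq> 0" "\<And>m. m \<in> E - ?V \<Longrightarrow> cmod (m f1) < cmod (e f1)"
      "\<And>m. m \<in> chars \<Longrightarrow> cmod (m f1) \<le> cmod (e f1)"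
    by auto
  define f where "f = emb (inverse (e f1)) * f1"
  have mf: "cmod (m f) = cmod (m f1) / cmod (e f1)" if "m \<in> chars" for m
    using that by (simp add: f_def char_emb_mult norm_mult norm_inverse divide_inverse_commute)
  have f_le: "cmod (m f) \<le> 1" if "m \<in> chars" for m
    using e that by (simp add: mf)
  have f_less: "cmod (m f) < 1" if "m \<in> E - ?V" for m
    using e that boundary_subset[OF E(1)] by (auto simp: mf subset_iff)
  have "\<exists>\<theta>. 0 \<le> \<theta> \<and> \<theta> < 1 \<and> (\<forall>m\<in>E - ?V. cmod (m f) \<le> \<theta>)"
  proof (cases "E - ?V = {}")
    case False
    have "compact (E - ?V)"
      using compact_chars E boundary_subset[OF E(1)] open_basic_nbhd[OF F]
      by (metis closed_Diff compact_Int_closed inf.absorb2 compact_diff)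
    moreover have "continuous_on (E - ?V) (\<lambda>m. cmod (m f))"
      by (intro continuous_intros continuous_on_subset[OF continuous_on_product_coordinates]) auto
    ultimately obtain m0 where "m0 \<in> E - ?V" "\<forall>m\<in>E - ?V. cmod (m f) \<le> cmod (m0 f)"
      using continuous_attains_sup[OF _ False] by blast
    then show ?thesis
      using f_less by (intro exI[of _ "cmod (m0 f)"]) auto
  qed auto
  then obtain \<theta> where \<theta>: "0 \<le> \<theta>" "\<theta> < 1" "\<And>m. m \<in> E - ?V \<Longrightarrow> cmod (m f) \<le> \<theta>"
    by blast
  \<comment> \<open>A power \<open>N\<close> with \<open>\<theta> ^ N * C < 1\<close> makes every
    \<open>g * u\<close> with \<open>u \<in> F\<close> smaller than \<open>1\<close> on all of
    \<open>E\<close>: inside \<open>?V\<close> because \<open>u\<close> is small, outside because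
    \<open>g\<close> is. The maximum modulus of \<open>g\<close> itself stays
    \<open>1\<close>.\<close>
  define C where "C = 1 + (\<Sum>u\<in>F. norm u)"
  have C: "C > 0" "\<And>u. u \<in> F \<Longrightarrow> norm u \<le> C"
    using F member_le_sum[of _ F norm] by (force simp: C_def intro!: add_pos_nonneg sum_nonneg)+
  obtain N where N: "\<theta> ^ N < 1 / C"
    using real_arch_pow_inv[of "1 / C" \<theta>] \<theta> C by auto
  define g where "g = f ^ N"
  have gu: "cmod (m (g * u)) < 1" if m: "m \<in> E" and u: "u \<in> F" for m u
  proof -
    have mc: "m \<in> chars"
      using m boundary_subset[OF E(1)] by blast
    have eq: "cmod (m (g * u)) = cmod (m f) ^ N * cmod (m u)"
      by (simp add: g_def char_mult[OF mc] char_power[OF mc] norm_mult norm_power)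
    show ?thesis
    proof (cases "m \<in> ?V")
      case True
      then have "cmod (m u) < 1"
        using u by (simp add: basic_nbhd_def)
      moreover have "cmod (m f) ^ N \<le> 1"
        using f_le[OF mc] by (simp add: power_le_one)
      ultimately show ?thesis
        unfolding eq using mult_right_mono[of "cmod (m f) ^ N" 1 "cmod (m u)"] by simp
    next
      case False
      then have "cmod (m f) ^ N * cmod (m u) \<le> \<theta> ^ N * C"
        using \<theta> m char_le_norm[OF mc, of u] C(2)[OF u] by (intro mult_mono power_mono) auto
      also have "\<dots> < 1"
        using N C by (simp add: field_simps)
      finally show ?thesis
        by (simp add: eq)
    qed
  qed
  \<comment> \<open>Since \<open>E\<close> is a boundary, the bound on \<open>g * u\<close> holds at
    \<open>b\<close> too; there \<open>cmod (b g) \<ge> 1\<close>, so every \<open>u\<close> is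
    small at \<open>b\<close>, which puts \<open>b\<close> into the neighbourhood that
    \<open>B\<close> avoids.\<close>
  obtain b where b: "b \<in> B" "\<And>m. m \<in> chars \<Longrightarrow> cmod (m g) \<le> cmod (b g)"
    using boundary_max[OF B(1)] by blast
  have bc: "b \<in> chars"
    using b boundary_subset[OF B(1)] by blast
  have ec: "e \<in> chars"
    using e boundary_subset[OF E(1)] by blast
  have "cmod (e g) = 1"
    using mf[OF ec] e(2) by (simp add: g_def char_power[OF ec] norm_power)
  then have bg: "cmod (b g) \<ge> 1"
    using b(2)[OF ec] by simp
  have "cmod (b u) < 1" if "u \<in> F" for u
  proof -
    obtain m where m: "m \<in> E" "cmod (b (g * u)) \<le> cmod (m (g * u))"
      using boundary_max[OF E(1), of "g * u"] bc by metis
    have "cmod (b u) \<le> cmod (b g) * cmod (b u)"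
      using bg mult_right_mono[of 1 "cmod (b g)" "cmod (b u)"] by simp
    also have "\<dots> = cmod (b (g * u))"
      by (simp add: char_mult[OF bc] norm_mult)
    also have "\<dots> < 1"
      using m gu[OF m(1) that] by simp
    finally show ?thesis .
  qed
  then have "b \<in> ?V"
    by (simp add: basic_nbhd_def)
  then show False
    using b B by blast
qed

lemma basic_nbhd_subset:
  assumes "open W" "m \<in> W"
  obtains F where "finite F" "m \<in> chars \<Longrightarrow> m \<in> basic_nbhd F" "chars \<inter> basic_nbhd F \<subseteq> W"
proof -
  have "openin (product_topology (\<lambda>i. euclidean) UNIV) W"
    using assms by (simp add: euclidean_product_topology)
  then obtain X where X: "m \<in> PiE UNIV X" "\<And>i. open (X i)" "finite {i. X i \<noteq> UNIV}" "PiE UNIV X \<subseteq> W"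
    using product_topology_open_contains_basis[of "\<lambda>i. euclidean" UNIV W m] assms by auto
  have "\<exists>e>0. ball (m i) e \<subseteq> X i" for i
    using X(1,2) by (meson PiE_mem UNIV_I open_contains_ball)
  then obtain e where e: "\<And>i. e i > 0" "\<And>i. ball (m i) (e i) \<subseteq> X i"
    by metis
  define F where "F = (\<lambda>i. emb (of_real (1 / e i)) * (i - emb (m i))) ` {i. X i \<noteq> UNIV}"
  have eval: "cmod (m' (emb (of_real (1 / e i)) * (i - emb (m i)))) = cmod (m' i - m i) / e i"
    if "m' \<in> chars" for m' i
    using e(1)[of i] that
    by (simp only: char_emb_mult char_diff char_emb norm_mult norm_of_real) (simp add: field_simps)
  show ?thesis
  proof
    show "finite F"
      using X(3) by (simp add: F_def)
    show "m \<in> basic_nbhd F" if "m \<in> chars"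
      using that unfolding basic_nbhd_def F_def by (simp add: eval del: of_real_divide of_real_1)
    show "chars \<inter> basic_nbhd F \<subseteq> W"
    proof
      fix m' assume m': "m' \<in> chars \<inter> basic_nbhd F"
      have "m' i \<in> X i" for i
      proof (cases "X i = UNIV")
        case False
        then have "cmod (m' i - m i) / e i < 1"
          using m' eval[of m' i] by (auto simp: basic_nbhd_def F_def)
        then have "m' i \<in> ball (m i) (e i)"
          using e(1)[of i] by (simp add: dist_norm norm_minus_commute)
        then show ?thesis
          using e(2) by blast
      qed simp
      then show "m' \<in> W"
        using X(4) by auto
    qed
  qed
qed

lemma shilov_subset: "chars \<noteq> {} \<Longrightarrow> shilov \<subseteq> chars"
  and is_boundary_chars: "chars \<noteq> {} \<Longrightarrow> is_boundary j chars"
proof -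
  assume ne: "chars \<noteq> {}"
  have "\<exists>m\<in>chars. \<forall>m'\<in>chars. cmod (m' f) \<le> cmod (m f)" for f
    by (intro continuous_attains_sup compact_chars ne continuous_intros
        continuous_on_subset[OF continuous_on_product_coordinates]) auto
  then show "is_boundary j chars"
    by (auto simp: is_boundary_def)
  then show "shilov \<subseteq> chars"
    unfolding shilov_boundary_def closedin_chars_iff using closed_chars by blast
qed

text \<open>If \<open>f\<close> had its maximum only off \<open>shilov\<close>, every point of the
  compact maximum set \<open>K\<close> would be missed by some closed boundary, hence have a basic
  neighbourhood disjoint from a boundary. Finitely many of these cover \<open>K\<close>; removing
  them one at a time from \<open>chars\<close> leaves a boundary without any point of
  \<open>K\<close>.\<close>

theorem is_boundary_shilov:
  assumes ne: "chars \<noteq> {}"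
  shows "is_boundary j shilov"
proof (rule ccontr)
  assume "\<not> ?thesis"
  then obtain f where f: "\<And>m. m \<in> shilov \<Longrightarrow> \<exists>m'\<in>chars. cmod (m f) < cmod (m' f)"
    using shilov_subset[OF ne] by (auto simp: is_boundary_def not_le)
  obtain s where s: "s \<in> chars" "\<And>m. m \<in> chars \<Longrightarrow> cmod (m f) \<le> cmod (s f)"
    using boundary_max[OF is_boundary_chars[OF ne]] by blast
  define K where "K = chars \<inter> {m. cmod (m f) = cmod (s f)}"
  have "compact K"
    unfolding K_def
    by (intro compact_Int_closed compact_chars closed_Collect_eq continuous_intros) simp_all
  have "\<exists>F. finite F \<and> m \<in> basic_nbhd F \<and> (\<exists>B. is_boundary j B \<and> B \<inter> basic_nbhd F = {})" if m: "m \<in> K" for m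
  proof -
    have "m \<notin> shilov"
    proof
      assume "m \<in> shilov"
      then obtain m' where "m' \<in> chars" "cmod (m f) < cmod (m' f)"
        using f by blast
      then show False
        using s(2)[of m'] m by (simp add: K_def)
    qed
    then obtain B where B: "is_boundary j B" "closed B" "m \<notin> B"
      unfolding shilov_boundary_def closedin_chars_iff by blast
    then obtain F where "finite F" "m \<in> chars \<Longrightarrow> m \<in> basic_nbhd F" "chars \<inter> basic_nbhd F \<subseteq> - B"
      using basic_nbhd_subset[of "- B" m] by (metis ComplI open_Compl)
    then show ?thesis
      using B m boundary_subset[OF B(1)] by (intro exI[of _ F]) (auto simp: K_def)
  qed
  then obtain F where F: "\<And>m. m \<in> K \<Longrightarrow> finite (F m)" "\<And>m. m \<in> K \<Longrightarrow> m \<in> basic_nbhd (F m)"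
    "\<And>m. m \<in> K \<Longrightarrow> \<exists>B. is_boundary j B \<and> B \<inter> basic_nbhd (F m) = {}"
    by metis
  obtain D where D: "D \<subseteq> K" "finite D" "K \<subseteq> (\<Union>m\<in>D. basic_nbhd (F m))"
    by (rule compactE_image[OF \<open>compact K\<close>, of K "\<lambda>m. basic_nbhd (F m)"])
      (use F in \<open>auto intro: open_basic_nbhd\<close>)
  have "is_boundary j (chars - (\<Union>m\<in>D'. basic_nbhd (F m))) \<and> closed (chars - (\<Union>m\<in>D'. basic_nbhd (F m)))"
    if "D' \<subseteq> D" for D'
    using finite_subset[OF that D(2)] that
  proof (induction D' rule: finite_induct)
    case empty
    then show ?case
      using is_boundary_chars[OF ne] closed_chars by simp
  next
    case (insert m D')
    have m: "m \<in> K"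
      using insert D by blast
    have eq: "chars - (\<Union>m\<in>insert m D'. basic_nbhd (F m))
        = (chars - (\<Union>m\<in>D'. basic_nbhd (F m))) - basic_nbhd (F m)"
      by blast
    show ?case
      unfolding eq using insert boundary_minus_basic_nbhd[OF F(1)[OF m]] F(3)[OF m] open_basic_nbhd[OF F(1)[OF m]]
      by (metis closed_Diff insert_subset)
  qed
  then obtain b where b: "b \<in> chars - (\<Union>m\<in>D. basic_nbhd (F m))" "cmod (s f) \<le> cmod (b f)"
    using boundary_max[of _ f] s(1) by (metis order_refl)
  then have "b \<in> K"
    using s(2)[of b] by (auto simp: K_def)
  then show False
    using b D by blast
qed

lemma chars_separate:
  assumes "semisimple TYPE('a)" "\<And>m. m \<in> chars \<Longrightarrow> m x = 0"
  shows "x = 0"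
proof (rule ccontr)
  assume "x \<noteq> 0"
  then obtain I where "maximal_ideal I" "x \<notin> I"
    using assms(1) unfolding semisimple_def by blast
  then show False
    using char_separating_max_ideal assms(2) by blast
qed

text \<open>An element vanishing on a boundary has maximum modulus \<open>0\<close>, so every
  character kills it. Characters exist, since otherwise even \<open>1\<close> would be
  \<open>0\<close>.\<close>

lemma shilov_separates:
  assumes "semisimple TYPE('a)" "\<And>t. t \<in> shilov \<Longrightarrow> t x = 0"
  shows "x = 0"
proof -
  have ne: "chars \<noteq> {}"
    using chars_separate[OF assms(1), of 1] by fastforce
  show ?thesis
  proof (rule chars_separate[OF assms(1)])
    fix m assume m: "m \<in> chars"
    obtain t where "t \<in> shilov" "cmod (m x) \<le> cmod (t x)"
      using boundary_max[OF is_boundary_shilov[OF ne], of x] m by metis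
    then show "m x = 0"
      using assms(2)[of t] by simp
  qed
qed

end

section \<open>Automorphisms acting on the Shilov boundary\<close>

context complex_banach_algebra
begin

lemma automorphism_inv:
  assumes U: "algebra_automorphism j U"
  shows "algebra_automorphism j (inv U)"
proof -
  have bij: "bij U" and UI: "U (inv U x) = x" "inv U (U x) = x" for x
    using U by (auto simp: algebra_automorphism_def bij_is_inj bij_is_surj surj_f_inv_f)
  have eqI: "inv U y = x" if "U x = y" for x y
    using that UI by auto
  show ?thesis
    using U unfolding algebra_automorphism_def
    by (auto intro!: bij_imp_bij_inv eqI simp: UI)
qed

lemma char_comp:
  assumes "algebra_automorphism j U" "m \<in> chars"
  shows "m \<circ> U \<in> chars"
  using assms by (auto simp: max_ideal_space_def algebra_automorphism_def)

text \<open>The preimage of a closed boundary under \<open>\<lambda>t. t \<circ> U\<close> is again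
  a closed boundary, so it contains \<open>t\<close>.\<close>

lemma shilov_comp:
  assumes U: "algebra_automorphism j U" and t: "t \<in> shilov"
  shows "t \<circ> U \<in> shilov"
  unfolding shilov_boundary_def closedin_chars_iff
proof (intro InterI CollectI, clarify)
  fix B assume B: "is_boundary j B" "closed B" "B \<subseteq> chars"
  define B' where "B' = chars \<inter> (\<lambda>t. t \<circ> U) -` B"
  have "continuous_on UNIV (\<lambda>t::'a \<Rightarrow> complex. t \<circ> U)"
    by (intro continuous_on_coordinatewise_then_product) simp
  then have "closed B'"
    unfolding B'_def using B(2) closed_chars by (intro closed_Int closed_vimage)
  moreover have "is_boundary j B'"
    unfolding is_boundary_def
  proof (intro conjI allI)
    fix f
    have UI: "U (inv U x) = x" "inv U (U x) = x" for x
      using U by (auto simp: algebra_automorphism_def bij_is_inj bij_is_surj surj_f_inv_f)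
    obtain b where b: "b \<in> B" "\<And>m. m \<in> chars \<Longrightarrow> cmod (m (inv U f)) \<le> cmod (b (inv U f))"
      using boundary_max[OF B(1)] by blast
    show "\<exists>m\<in>B'. \<forall>m'\<in>chars. cmod (m' f) \<le> cmod (m f)"
    proof (intro bexI ballI)
      show "b \<circ> inv U \<in> B'"
        using b B char_comp[OF automorphism_inv[OF U]] by (auto simp: B'_def o_def UI)
      fix m' assume "m' \<in> chars"
      then show "cmod (m' f) \<le> cmod ((b \<circ> inv U) f)"
        using b(2)[OF char_comp[OF U]] by (simp add: UI)
    qed
  qed (simp add: B'_def)
  ultimately have "t \<in> B'"
    using t unfolding shilov_boundary_def closedin_chars_iff B'_def by blast
  then show "t \<circ> U \<in> B"
    by (simp add: B'_def)
qed

text \<open>The separating continuous functionals \<open>m\<close> and \<open>m \<circ> U\<close> give \<open>U\<close> a closed graph.\<close>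

lemma automorphism_bounded_linear:
  assumes "semisimple TYPE('a)" and U: "algebra_automorphism j U"
  shows "bounded_linear U"
proof (rule closed_graph_bounded_linear)
  show "linear U"
  proof (rule linearI)
    show "U (r *\<^sub>R x) = r *\<^sub>R U x" for r x
      using U unfolding algebra_automorphism_def cscale_eq
      by (metis emb_of_real scaleR_conv_of_real)
  qed (use U in \<open>simp add: algebra_automorphism_def\<close>)
  fix X x y
  assume X: "X \<longlonglongrightarrow> x" and UX: "(\<lambda>n. U (X n)) \<longlonglongrightarrow> y"
  have "U x - y = 0"
  proof (rule chars_separate[OF assms(1)])
    fix m assume m: "m \<in> chars"
    have "(\<lambda>n. m (U (X n))) \<longlonglongrightarrow> m y"
      by (rule bounded_linear.tendsto[OF bounded_linear_char[OF m] UX])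
    moreover have "(\<lambda>n. m (U (X n))) \<longlonglongrightarrow> m (U x)"
      using bounded_linear.tendsto[OF bounded_linear_char[OF char_comp[OF U m]] X] by simp
    ultimately have "m (U x) = m y"
      by (rule LIMSEQ_unique[symmetric])
    then show "m (U x - y) = 0"
      by (simp add: char_diff[OF m])
  qed
  then show "U x = y"
    by simp
qed

end

section \<open>Resolvents\<close>

locale bounded_complex_operator = complex_banach_algebra +
  fixes T :: "'a \<Rightarrow> 'a"
  assumes bounded_linear_T: "bounded_linear T"
    and T_emb: "T (emb c * x) = emb c * T x"
begin

sublocale T: bounded_linear T
  by (rule bounded_linear_T)

definition shift :: "complex \<Rightarrow> 'a \<Rightarrow> 'a" where
  "shift c x = T x - emb c * x"

text \<open>Bijectivity alone is asked for; the bound that \<open>op_spectrum\<close> demands of the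
  inverse comes from the closed graph theorem.\<close>

definition resolvent_set :: "complex set" where
  "resolvent_set = {c. bij (shift c)}"

definition R :: "complex \<Rightarrow> 'a \<Rightarrow> 'a" where
  "R c = inv (shift c)"

lemma shift_R: "c \<in> resolvent_set \<Longrightarrow> shift c (R c x) = x"
  and R_shift: "c \<in> resolvent_set \<Longrightarrow> R c (shift c x) = x"
  by (auto simp: resolvent_set_def R_def bij_is_inj bij_is_surj surj_f_inv_f)

lemma bounded_linear_shift: "bounded_linear (shift c)"
  unfolding shift_def
  by (intro bounded_linear_sub bounded_linear_T bounded_linear_mult_right)

lemma bounded_linear_R:
  assumes c: "c \<in> resolvent_set"
  shows "bounded_linear (R c)"
proof (rule closed_graph_bounded_linear)
  interpret s: bounded_linear "shift c"
    by (rule bounded_linear_shift)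
  show "linear (R c)"
  proof (rule linearI)
    show "R c (x + y) = R c x + R c y" for x y
      by (metis R_shift[OF c] shift_R[OF c] s.add)
    show "R c (r *\<^sub>R x) = r *\<^sub>R R c x" for r x
      by (metis R_shift[OF c] shift_R[OF c] s.scaleR)
  qed
  fix X x y
  assume X: "X \<longlonglongrightarrow> x" and RX: "(\<lambda>n. R c (X n)) \<longlonglongrightarrow> y"
  have "X \<longlonglongrightarrow> shift c y"
    using s.tendsto[OF RX] by (simp add: shift_R[OF c])
  then have "x = shift c y"
    using X LIMSEQ_unique by blast
  then show "R c x = y"
    by (simp add: R_shift[OF c])
qed

lemma op_spectrum_eq: "op_spectrum j T = - resolvent_set"
proof -
  have "c \<in> op_spectrum j T \<longleftrightarrow> c \<notin> resolvent_set" for c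
  proof
    assume spec: "c \<in> op_spectrum j T"
    show "c \<notin> resolvent_set"
    proof
      assume c: "c \<in> resolvent_set"
      obtain K where "\<And>x. norm (R c x) \<le> norm x * K"
        using bounded_linear.bounded[OF bounded_linear_R[OF c]] by blast
      then have "\<forall>x. norm (R c x) \<le> K * norm x"
        by (simp add: mult.commute)
      then show False
        using spec shift_R[OF c] R_shift[OF c]
        unfolding op_spectrum_def cscale_eq shift_def by blast
    qed
  next
    assume "c \<notin> resolvent_set"
    then have "\<not> (\<exists>S. (\<forall>x. S (shift c x) = x) \<and> (\<forall>x. shift c (S x) = x))"
      unfolding resolvent_set_def by (metis bijI' mem_Collect_eq)
    then show "c \<in> op_spectrum j T"
      unfolding op_spectrum_def cscale_eq shift_def by blast
  qed
  then show ?thesis by blast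
qed

text \<open>\<open>shift d\<close> is \<open>shift c\<close> followed by
  \<open>1 - (d - c) R c\<close>, and the latter is invertible for \<open>d\<close> close to
  \<open>c\<close>.\<close>

lemma open_resolvent_set: "open resolvent_set"
  unfolding open_contains_ball
proof
  fix c assume c: "c \<in> resolvent_set"
  interpret R: bounded_linear "R c"
    by (rule bounded_linear_R[OF c])
  obtain K where K: "K > 0" "\<And>x. norm (R c x) \<le> norm x * K"
    using R.pos_bounded by blast
  have "ball c (1 / K) \<subseteq> resolvent_set"
  proof
    fix d assume "d \<in> ball c (1 / K)"
    then have d: "cmod (d - c) * K < 1"
      using K by (simp add: dist_norm norm_minus_commute field_simps)
    have "bij (\<lambda>x. x - emb (d - c) * R c x)"
    proof (rule bij_id_minus_contraction)
      show "linear (\<lambda>x. emb (d - c) * R c x)"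
        by (intro bounded_linear.linear bounded_linear_const_mult bounded_linear_R c)
      show "norm (emb (d - c) * R c x) \<le> cmod (d - c) * K * norm x" for x
        using mult_left_mono[OF K(2), of "cmod (d - c)" x] unfolding norm_emb_mult by (simp add: mult_ac)
    qed fact
    moreover have "bij (shift c)"
      using c by (simp add: resolvent_set_def)
    ultimately have "bij ((\<lambda>x. x - emb (d - c) * R c x) \<circ> shift c)"
      by (rule bij_comp[rotated])
    moreover have "(\<lambda>x. x - emb (d - c) * R c x) \<circ> shift c = shift d"
      by (auto simp: R_shift[OF c] fun_eq_iff) (simp add: shift_def emb_diff algebra_simps)
    ultimately show "d \<in> resolvent_set"
      by (simp add: resolvent_set_def)
  qed
  then show "\<exists>e>0. ball c e \<subseteq> resolvent_set"
    using K by (intro exI[of _ "1 / K"]) auto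
qed

lemma bounded_Compl_resolvent_set: "bounded (- resolvent_set)"
proof -
  obtain K where K: "K > 0" "\<And>x. norm (T x) \<le> norm x * K"
    using T.pos_bounded by blast
  have "c \<in> resolvent_set" if c: "cmod c > K" for c
  proof -
    have c0: "c \<noteq> 0"
      using c K by auto
    have "bij (\<lambda>x. x - emb (inverse c) * T x)"
    proof (rule bij_id_minus_contraction)
      show "linear (\<lambda>x. emb (inverse c) * T x)"
        by (intro bounded_linear.linear bounded_linear_const_mult bounded_linear_T)
      show "norm (emb (inverse c) * T x) \<le> K / cmod c * norm x" for x
        using mult_left_mono[OF K(2), of "cmod (inverse c)" x]
        unfolding norm_emb_mult by (simp add: norm_inverse divide_inverse mult_ac)
      show "K / cmod c < 1"
        using c K(1) by (simp add: divide_less_eq)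
    qed
    moreover have "bij (\<lambda>x. emb (- c) * x)"
      using c0 by (intro o_bij[of "\<lambda>x. emb (- inverse c) * x"])
        (auto simp: fun_eq_iff simp flip: mult.assoc emb_mult)
    ultimately have "bij ((\<lambda>x. emb (- c) * x) \<circ> (\<lambda>x. x - emb (inverse c) * T x))"
      by (rule bij_comp)
    moreover have "(\<lambda>x. emb (- c) * x) \<circ> (\<lambda>x. x - emb (inverse c) * T x) = shift c"
      using emb_inverse[OF c0] by (auto simp: fun_eq_iff shift_def emb_minus algebra_simps)
    ultimately show ?thesis
      by (simp add: resolvent_set_def)
  qed
  then have "- resolvent_set \<subseteq> cball 0 K"
    by (auto simp: not_less[symmetric])
  then show ?thesis
    using bounded_subset bounded_cball by blast
qed

text \<open>This makes the integrand along a loop integrable. As in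
  \<open>continuous_if_resolvent_bound\<close>, half of \<open>norm (R c x)\<close> is absorbed
  before the resolvent identity gives an estimate.\<close>

lemma continuous_on_R: "continuous_on resolvent_set (\<lambda>c. R c x)"
proof (rule continuous_at_imp_continuous_on, intro ballI)
  fix d assume d: "d \<in> resolvent_set"
  interpret R: bounded_linear "R d"
    by (rule bounded_linear_R[OF d])
  obtain K where K: "K > 0" "\<And>x. norm (R d x) \<le> norm x * K"
    using R.pos_bounded by blast
  have bound: "norm (R c x - R d x) \<le> cmod (c - d) * (2 * K * norm (R d x))"
    if c: "c \<in> resolvent_set" "cmod (c - d) < 1 / (2 * K)" for c
  proof -
    have "shift d (R c x) = x + emb (c - d) * R c x"
      using shift_R[OF c(1), of x] by (simp add: shift_def emb_diff algebra_simps)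
    then have "R c x = R d x + R d (emb (c - d) * R c x)"
      by (metis R_shift[OF d] R.add)
    then have "R c x - R d x = R d (emb (c - d) * R c x)"
      by (metis add_diff_cancel_left')
    then have "norm (R c x - R d x) \<le> cmod (c - d) * K * norm (R c x)"
      using K(2)[of "emb (c - d) * R c x"] unfolding norm_emb_mult by (simp add: mult_ac)
    moreover have "cmod (c - d) * K * norm (R c x) \<le> (1 / 2) * norm (R c x)"
      using c K by (intro mult_right_mono) (auto simp: field_simps)
    ultimately have le: "norm (R c x) \<le> 2 * norm (R d x)"
      and le': "norm (R c x - R d x) \<le> cmod (c - d) * K * norm (R c x)"
      using norm_triangle_ineq2[of "R c x" "R d x"] by auto
    show ?thesis
      by (rule order_trans[OF le']) (use mult_left_mono[OF le, of "cmod (c - d) * K"] K(1) in \<open>simp add: mult_ac\<close>)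
  qed
  have "((\<lambda>c. R c x - R d x) \<longlongrightarrow> 0) (at d)"
  proof (rule Lim_null_comparison)
    have "\<forall>\<^sub>F c in at d. c \<in> resolvent_set"
      using open_resolvent_set d by (simp add: eventually_at_in_open')
    moreover have "\<forall>\<^sub>F c in at d. cmod (c - d) < 1 / (2 * K)"
      using K by (auto simp: eventually_at dist_norm intro!: exI[of _ "1 / (2 * K)"])
    ultimately show "\<forall>\<^sub>F c in at d. norm (R c x - R d x) \<le> cmod (c - d) * (2 * K * norm (R d x))"
      by eventually_elim (use bound in auto)
    have "((\<lambda>c. cmod (c - d) * (2 * K * norm (R d x))) \<longlongrightarrow> cmod (d - d) * (2 * K * norm (R d x))) (at d)"
      by (intro tendsto_intros)
    then show "((\<lambda>c. cmod (c - d) * (2 * K * norm (R d x))) \<longlongrightarrow> 0) (at d)"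
      by simp
  qed
  then show "isCont (\<lambda>c. R c x) d"
    by (simp add: isCont_def LIM_zero_iff)
qed

end

context complex_banach_algebra
begin

text \<open>The real \<open>SUP\<close> is meaningful only for sets bounded above; this makes the
  one in \<open>check_spectrum\<close> the genuine sup norm.\<close>

lemma shilov_bounded_eval:
  assumes "shilov \<subseteq> chars" "g \<in> check_alg j"
  shows "bdd_above ((\<lambda>t. cmod (g t)) ` shilov)"
proof -
  obtain f where f: "\<And>t. t \<in> shilov \<Longrightarrow> cmod (g t - t f) < 1"
    using assms(2) by (auto simp: check_alg_def) (meson zero_less_one)
  have "cmod (g t) \<le> 1 + norm f" if t: "t \<in> shilov" for t
    using f[OF t] char_le_norm[of t f] t assms(1) norm_triangle_ineq2[of "g t" "t f"] by fastforce
  then show ?thesis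
    by (intro bdd_aboveI2)
qed

end

section \<open>Weighted automorphisms\<close>

locale weighted_automorphism = complex_banach_algebra +
  fixes U :: "'a \<Rightarrow> 'a" and w :: 'a
  assumes semisimple: "semisimple TYPE('a)"
    and automorphism: "algebra_automorphism j U"
begin

lemma shilov_boundary: "is_boundary j shilov"
proof -
  have "chars \<noteq> {}"
    using chars_separate[OF semisimple, of 1] by fastforce
  then show ?thesis
    by (rule is_boundary_shilov)
qed

lemma shilov_chars: "t \<in> shilov \<Longrightarrow> t \<in> chars"
  using boundary_subset[OF shilov_boundary] by blast

lemma shilov_nonempty: "shilov \<noteq> {}"
  using shilov_boundary by (auto simp: is_boundary_def)

lemma shilov_U: "t \<in> shilov \<Longrightarrow> t \<circ> U \<in> shilov"
  using automorphism by (rule shilov_comp)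

definition T :: "'a \<Rightarrow> 'a" where
  "T f = w * U f"

sublocale bounded_complex_operator j T
proof (intro bounded_complex_operator.intro complex_banach_algebra_axioms bounded_complex_operator_axioms.intro)
  show "bounded_linear T"
    unfolding T_def
    by (intro bounded_linear_const_mult automorphism_bounded_linear semisimple automorphism)
  show "T (emb c * x) = emb c * T x" for c x
    using automorphism unfolding T_def algebra_automorphism_def cscale_eq by (metis mult.left_commute)
qed

abbreviation C :: "(('a \<Rightarrow> complex) \<Rightarrow> complex) set" where
  "C \<equiv> check_alg j"

abbreviation Tc :: "(('a \<Rightarrow> complex) \<Rightarrow> complex) \<Rightarrow> (('a \<Rightarrow> complex) \<Rightarrow> complex)" where
  "Tc \<equiv> check_op j w U"

definition sup_norm :: "(('a \<Rightarrow> complex) \<Rightarrow> complex) \<Rightarrow> real" where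
  "sup_norm g = (SUP t\<in>shilov. cmod (g t))"

text \<open>The default \<open>0\<close> is the one of \<open>check_alg\<close>, so that equality of
  total functions is equality on the Shilov boundary.\<close>

definition check :: "'a \<Rightarrow> ('a \<Rightarrow> complex) \<Rightarrow> complex" where
  "check f t = (if t \<in> shilov then t f else 0)"

lemma C_outside: "g \<in> C \<Longrightarrow> t \<notin> shilov \<Longrightarrow> g t = 0"
  by (simp add: check_alg_def)

lemma C_approx: "g \<in> C \<Longrightarrow> e > 0 \<Longrightarrow> \<exists>f. \<forall>t\<in>shilov. cmod (g t - t f) < e"
  by (simp add: check_alg_def)

lemma C_linear:
  assumes g: "g \<in> C" and h: "h \<in> C"
  shows "(\<lambda>t. a * g t + b * h t) \<in> C"
  unfolding check_alg_def
proof (intro CollectI conjI allI impI)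
  fix e :: real assume "e > 0"
  define \<delta> where "\<delta> = e / (cmod a + cmod b + 1)"
  have pos: "cmod a + cmod b + 1 > 0"
    by (intro add_nonneg_pos add_nonneg_nonneg) auto
  then have "\<delta> > 0"
    using \<open>e > 0\<close> by (simp add: \<delta>_def)
  obtain f where f: "\<And>t. t \<in> shilov \<Longrightarrow> cmod (g t - t f) < \<delta>"
    using C_approx[OF g \<open>\<delta> > 0\<close>] by blast
  obtain k where k: "\<And>t. t \<in> shilov \<Longrightarrow> cmod (h t - t k) < \<delta>"
    using C_approx[OF h \<open>\<delta> > 0\<close>] by blast
  have "cmod (a * g t + b * h t - t (emb a * f + emb b * k)) < e" if t: "t \<in> shilov" for t
  proof -
    have "a * g t + b * h t - t (emb a * f + emb b * k) = a * (g t - t f) + b * (h t - t k)"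
      by (simp add: char_add[OF shilov_chars[OF t]] char_emb_mult[OF shilov_chars[OF t]] right_diff_distrib)
    also have "cmod \<dots> \<le> cmod a * cmod (g t - t f) + cmod b * cmod (h t - t k)"
      by (metis norm_mult norm_triangle_ineq)
    also have "\<dots> \<le> cmod a * \<delta> + cmod b * \<delta>"
      using f[OF t] k[OF t] by (intro add_mono mult_left_mono) auto
    also have "\<dots> < (cmod a + cmod b + 1) * \<delta>"
      using \<open>\<delta> > 0\<close> by (simp add: algebra_simps)
    also have "\<dots> = e"
      using pos by (simp add: \<delta>_def)
    finally show ?thesis .
  qed
  then show "\<exists>f. \<forall>t\<in>shilov. cmod (a * g t + b * h t - t f) < e"
    by blast
qed (use g h in \<open>simp add: C_outside\<close>)

lemma check_in_C: "check f \<in> C"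
  unfolding check_alg_def check_def by (auto intro!: exI[of _ f])

lemma check_eqD:
  assumes "check f = check g"
  shows "f = g"
proof -
  have "f - g = 0"
  proof (rule shilov_separates[OF semisimple])
    fix t assume "t \<in> shilov"
    then show "t (f - g) = 0"
      using fun_cong[OF assms, of t] shilov_chars by (simp add: check_def char_diff)
  qed
  then show ?thesis by simp
qed

text \<open>\<open>check\<close> intertwines \<open>T\<close> with \<open>Tc\<close>, so it matches
  their resolvents wherever both exist.\<close>

lemma check_shift: "(\<lambda>t. Tc (check f) t - c * check f t) = check (shift c f)"
  using shilov_U shilov_chars
  by (auto simp: fun_eq_iff check_op_def check_def shift_def T_def char_diff char_mult char_emb)

lemma Tc_linear: "Tc (\<lambda>t. a * g t + b * h t) t = a * Tc g t + b * Tc h t"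
  by (simp add: check_op_def algebra_simps)

lemma Tc_in_C:
  assumes g: "g \<in> C"
  shows "Tc g \<in> C"
  unfolding check_alg_def
proof (intro CollectI conjI allI impI)
  fix e :: real assume "e > 0"
  define \<delta> where "\<delta> = e / (norm w + 1)"
  have pos: "norm w + 1 > 0"
    by (intro add_nonneg_pos) auto
  then have "\<delta> > 0"
    using \<open>e > 0\<close> by (simp add: \<delta>_def)
  obtain f where f: "\<And>t. t \<in> shilov \<Longrightarrow> cmod (g t - t f) < \<delta>"
    using C_approx[OF g \<open>\<delta> > 0\<close>] by blast
  have "cmod (Tc g t - t (T f)) < e" if t: "t \<in> shilov" for t
  proof -
    have "Tc g t - t (T f) = t w * (g (t \<circ> U) - (t \<circ> U) f)"
      using t shilov_chars[OF t] by (simp add: check_op_def T_def char_mult algebra_simps)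
    then have "cmod (Tc g t - t (T f)) = cmod (t w) * cmod (g (t \<circ> U) - (t \<circ> U) f)"
      by (simp add: norm_mult)
    also have "\<dots> \<le> norm w * \<delta>"
      using f[OF shilov_U[OF t]] char_le_norm[OF shilov_chars[OF t]] by (intro mult_mono) auto
    also have "\<dots> < (norm w + 1) * \<delta>"
      using \<open>\<delta> > 0\<close> by (simp add: algebra_simps)
    also have "\<dots> = e"
      using pos by (simp add: \<delta>_def)
    finally show ?thesis .
  qed
  then show "\<exists>f. \<forall>t\<in>shilov. cmod (Tc g t - t f) < e"
    by blast
qed (simp add: check_op_def)

lemma eval_le_sup_norm: "g \<in> C \<Longrightarrow> t \<in> shilov \<Longrightarrow> cmod (g t) \<le> sup_norm g"
  unfolding sup_norm_def
  by (intro cSUP_upper shilov_bounded_eval) (auto intro: shilov_chars)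

lemma sup_norm_leI: "(\<And>t. t \<in> shilov \<Longrightarrow> cmod (g t) \<le> c) \<Longrightarrow> sup_norm g \<le> c"
  unfolding sup_norm_def using shilov_nonempty by (rule cSUP_least)

lemma sup_norm_nonneg: "g \<in> C \<Longrightarrow> 0 \<le> sup_norm g"
  using shilov_nonempty eval_le_sup_norm[of g] by (meson all_not_in_conv norm_ge_zero order_trans)

lemma sup_norm_linear:
  assumes "g \<in> C" "h \<in> C"
  shows "sup_norm (\<lambda>t. a * g t + b * h t) \<le> cmod a * sup_norm g + cmod b * sup_norm h"
proof (rule sup_norm_leI)
  fix t assume t: "t \<in> shilov"
  have "cmod (a * g t + b * h t) \<le> cmod a * cmod (g t) + cmod b * cmod (h t)"
    by (metis norm_mult norm_triangle_ineq)
  also have "\<dots> \<le> cmod a * sup_norm g + cmod b * sup_norm h"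
    using assms t by (intro add_mono mult_left_mono eval_le_sup_norm) auto
  finally show "cmod (a * g t + b * h t) \<le> cmod a * sup_norm g + cmod b * sup_norm h" .
qed

text \<open>The condition inside \<open>check_spectrum\<close>, under a name. It constrains
  \<open>S\<close> on \<open>C\<close> only, and linearity of \<open>S\<close> there is derived from
  uniqueness of solutions.\<close>

definition check_inverse ::
  "complex \<Rightarrow> ((('a \<Rightarrow> complex) \<Rightarrow> complex) \<Rightarrow> (('a \<Rightarrow> complex) \<Rightarrow> complex)) \<Rightarrow> bool" where
  "check_inverse c S \<longleftrightarrow> (\<forall>g\<in>C. S g \<in> C) \<and> (\<forall>g\<in>C. S (\<lambda>t. Tc g t - c * g t) = g) \<and>
    (\<forall>g\<in>C. (\<lambda>t. Tc (S g) t - c * S g t) = g) \<and> (\<exists>K. \<forall>g\<in>C. sup_norm (S g) \<le> K * sup_norm g)"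

lemma notin_check_spectrum_iff: "c \<notin> check_spectrum j Tc \<longleftrightarrow> (\<exists>S. check_inverse c S)"
  unfolding check_spectrum_def check_inverse_def sup_norm_def by (simp add: Let_def)

lemma
  assumes "check_inverse c S" "g \<in> C"
  shows check_inverse_in_C: "S g \<in> C"
    and check_inverse_left: "S (\<lambda>t. Tc g t - c * g t) = g"
    and check_inverse_right: "Tc (S g) t = g t + c * S g t"
proof -
  show "S g \<in> C" "S (\<lambda>t. Tc g t - c * g t) = g"
    using assms by (auto simp: check_inverse_def)
  have "(\<lambda>t. Tc (S g) t - c * S g t) = g"
    using assms by (auto simp: check_inverse_def)
  then show "Tc (S g) t = g t + c * S g t"
    by (metis diff_add_cancel)
qed

lemma check_inverse_bound:
  assumes "check_inverse c S"
  obtains K where "K > 0" "\<And>g. g \<in> C \<Longrightarrow> sup_norm (S g) \<le> K * sup_norm g"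
proof -
  obtain K where K: "\<And>g. g \<in> C \<Longrightarrow> sup_norm (S g) \<le> K * sup_norm g"
    using assms unfolding check_inverse_def by blast
  show ?thesis
  proof
    show "max K 1 > 0" by simp
    show "sup_norm (S g) \<le> max K 1 * sup_norm g" if "g \<in> C" for g
      using K[OF that] sup_norm_nonneg[OF that] by (meson max.cobounded1 mult_right_mono order_trans)
  qed
qed

text \<open>To compute \<open>S g\<close> it suffices to exhibit a solution in \<open>C\<close>;
  linearity, the resolvent identity and the passage to inverses all go through this.\<close>

lemma check_inverse_eqI:
  assumes S: "check_inverse c S" and "x \<in> C" "\<And>t. Tc x t - c * x t = g t"
  shows "S g = x"
proof -
  have "(\<lambda>t. Tc x t - c * x t) = g"
    using assms(3) by blast
  then show ?thesis
    using check_inverse_left[OF S \<open>x \<in> C\<close>] by simp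
qed

lemma check_inverse_linear:
  assumes S: "check_inverse c S" and g: "g \<in> C" and h: "h \<in> C"
  shows "S (\<lambda>t. a * g t + b * h t) = (\<lambda>t. a * S g t + b * S h t)"
  by (rule check_inverse_eqI[OF S])
    (use check_inverse_in_C[OF S] g h in
      \<open>auto intro!: C_linear simp: Tc_linear check_inverse_right[OF S] algebra_simps\<close>)

lemma check_inverse_resolvent:
  assumes S: "check_inverse c S" and S': "check_inverse d S'" and g: "g \<in> C"
  shows "S g t - S' g t = (c - d) * S' (S g) t"
proof -
  have "S' (\<lambda>t. 1 * g t + (c - d) * S g t) = S g"
    by (rule check_inverse_eqI[OF S' check_inverse_in_C[OF S g]])
      (simp add: check_inverse_right[OF S g] algebra_simps)
  then have "S g t = S' (\<lambda>t. 1 * g t + (c - d) * S g t) t"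
    by simp
  also have "\<dots> = S' g t + (c - d) * S' (S g) t"
    using check_inverse_linear[OF S' g check_inverse_in_C[OF S g], of 1 "c - d"] by simp
  finally show ?thesis
    by simp
qed

text \<open>By the resolvent identity the difference quotient at \<open>d\<close> equals
  \<open>S c (S d g) t\<close>, so continuity at \<open>d\<close>, applied to \<open>S d g\<close>,
  already yields the derivative.\<close>

lemma check_resolvent_holomorphic:
  assumes "open D" and S: "\<And>c. c \<in> D \<Longrightarrow> check_inverse c (S c)" and g: "g \<in> C" and t: "t \<in> shilov"
  shows "(\<lambda>c. S c g t) holomorphic_on D"
proof -
  have cont: "((\<lambda>c. S c g t) \<longlongrightarrow> S d g t) (at d)" if d: "d \<in> D" and g: "g \<in> C" for d g
  proof -
    obtain K where K: "K > 0" "\<And>g. g \<in> C \<Longrightarrow> sup_norm (S d g) \<le> K * sup_norm g"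
      using check_inverse_bound[OF S[OF d]] by blast
    have bound: "cmod (S c g t - S d g t) \<le> cmod (c - d) * (2 * K * sup_norm (S d g))"
      if c: "c \<in> D" "cmod (c - d) < 1 / (2 * K)" for c
    proof -
      have gC: "S c g \<in> C" "S d g \<in> C" "S d (S c g) \<in> C"
        using check_inverse_in_C[OF S] c d g by auto
      have *: "S c g t = S d g t + (c - d) * S d (S c g) t" for t
        using check_inverse_resolvent[OF S[OF c(1)] S[OF d] g, of t] by (simp add: algebra_simps)
      have "S c g = (\<lambda>t. 1 * S d g t + (c - d) * S d (S c g) t)"
        using * by auto
      then have "sup_norm (S c g) \<le> sup_norm (S d g) + cmod (c - d) * sup_norm (S d (S c g))"
        using sup_norm_linear[OF gC(2,3), of 1 "c - d"] by simp
      also have "\<dots> \<le> sup_norm (S d g) + cmod (c - d) * (K * sup_norm (S c g))"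
        using K(2)[OF gC(1)] by (intro add_left_mono mult_left_mono) auto
      also have "\<dots> = sup_norm (S d g) + (cmod (c - d) * K) * sup_norm (S c g)"
        by simp
      also have "\<dots> \<le> sup_norm (S d g) + (1 / 2) * sup_norm (S c g)"
        using c K sup_norm_nonneg[OF gC(1)]
        by (intro add_left_mono mult_right_mono) (auto simp: field_simps)
      finally have le: "sup_norm (S c g) \<le> 2 * sup_norm (S d g)"
        by simp
      have "cmod (S c g t - S d g t) = cmod (c - d) * cmod (S d (S c g) t)"
        by (simp add: * norm_mult)
      also have "\<dots> \<le> cmod (c - d) * (K * (2 * sup_norm (S d g)))"
      proof (rule mult_left_mono)
        have "cmod (S d (S c g) t) \<le> K * sup_norm (S c g)"
          using eval_le_sup_norm[OF gC(3) t] K(2)[OF gC(1)] by simp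
        also have "\<dots> \<le> K * (2 * sup_norm (S d g))"
          using le K by (intro mult_left_mono) auto
        finally show "cmod (S d (S c g) t) \<le> K * (2 * sup_norm (S d g))" .
      qed simp
      finally show ?thesis
        by (simp add: mult_ac)
    qed
    have "((\<lambda>c. S c g t - S d g t) \<longlongrightarrow> 0) (at d)"
    proof (rule Lim_null_comparison)
      have "\<forall>\<^sub>F c in at d. c \<in> D"
        using \<open>open D\<close> d by (simp add: eventually_at_in_open')
      moreover have "\<forall>\<^sub>F c in at d. cmod (c - d) < 1 / (2 * K)"
        using K by (auto simp: eventually_at dist_norm intro!: exI[of _ "1 / (2 * K)"])
      ultimately show "\<forall>\<^sub>F c in at d. norm (S c g t - S d g t) \<le> cmod (c - d) * (2 * K * sup_norm (S d g))"
        by eventually_elim (use bound in auto)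
      have "((\<lambda>c. cmod (c - d) * (2 * K * sup_norm (S d g))) \<longlongrightarrow>
          cmod (d - d) * (2 * K * sup_norm (S d g))) (at d)"
        by (intro tendsto_intros)
      then show "((\<lambda>c. cmod (c - d) * (2 * K * sup_norm (S d g))) \<longlongrightarrow> 0) (at d)"
        by simp
    qed
    then show ?thesis
      by (simp add: LIM_zero_iff)
  qed
  have "((\<lambda>c. S c g t) has_field_derivative S d (S d g) t) (at d)" if d: "d \<in> D" for d
    unfolding has_field_derivative_iff
  proof (rule Lim_transform_within_open[OF cont[OF d check_inverse_in_C[OF S[OF d] g]] \<open>open D\<close> d])
    fix c assume c: "c \<in> D" "c \<noteq> d"
    have "S d g t - S c g t = (d - c) * S c (S d g) t"
      by (rule check_inverse_resolvent[OF S[OF d] S[OF c(1)] g])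
    then have "S c g t - S d g t = (c - d) * S c (S d g) t"
      by (simp add: algebra_simps)
    then show "S c (S d g) t = (S c g t - S d g t) / (c - d)"
      using c by simp
  qed
  then show ?thesis
    using holomorphic_on_open[OF \<open>open D\<close>] by blast
qed

section \<open>Filling loops in the resolvent set\<close>

proposition loop_filled:
  assumes noncheck: "\<And>c. cmod c < 1 \<Longrightarrow> c \<notin> check_spectrum j Tc"
    and p: "polynomial_function p" "pathfinish p = pathstart p"
      "path_image p \<subseteq> ball 0 1 \<inter> resolvent_set"
    and z: "z \<notin> path_image p" "winding_number p z \<noteq> 0"
  shows "z \<in> ball 0 1 \<inter> resolvent_set"
proof -
  have "\<forall>c\<in>ball 0 1. \<exists>S. check_inverse c S"
    using noncheck notin_check_spectrum_iff by simp
  then obtain S where S: "\<And>c. c \<in> ball 0 1 \<Longrightarrow> check_inverse c (S c)"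
    by metis
  have S_check: "S c (check (shift c f)) = check f" if "c \<in> ball 0 1" for c f
    using check_inverse_left[OF S[OF that] check_in_C[of f]] by (simp add: check_shift)
  \<comment> \<open>The ball is convex, so a loop in it has winding number \<open>0\<close> about
    every point outside.\<close>
  have zD: "z \<in> ball 0 1"
    using winding_number_zero_outside[of p "ball 0 1" z] p z by (auto simp: path_polynomial_function)
  obtain p' where p': "polynomial_function p'" "\<And>s. (p has_vector_derivative p' s) (at s)"
    using has_vector_derivative_polynomial_function[OF p(1)] by blast
  have ps: "p s \<in> ball 0 1" "p s \<in> resolvent_set" "p s \<noteq> z" if "s \<in> {0..1}" for s
    using subsetD[OF p(3), of "p s"] z(1) that by (auto simp: path_image_def)
  have "\<exists>G. shift z G = f" for f
  proof -
    \<comment> \<open>The Cauchy integrand \<open>R c f / (c - z)\<close> with values in the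
      algebra, pulled back to the parameter interval of the loop.\<close>
    define H where "H s = emb (p' s / (p s - z)) * R (p s) f" for s
    have "continuous_on {0..1} H"
      unfolding H_def
    proof (intro continuous_on_mult)
      have "continuous_on UNIV emb"
        unfolding emb_def by (intro continuous_intros)
      moreover have "continuous_on {0..1} (\<lambda>s. p' s / (p s - z))"
        using p p' ps by (intro continuous_intros continuous_on_polymonial_function) auto
      ultimately show "continuous_on {0..1} (\<lambda>s. emb (p' s / (p s - z)))"
        by (rule continuous_on_compose2) auto
      show "continuous_on {0..1} (\<lambda>s. R (p s) f)"
        using ps(2) p(1)
        by (intro continuous_on_compose2[OF continuous_on_R] continuous_on_polymonial_function) auto
    qed
    then have int: "(H has_integral integral {0..1} H) {0..1}"
      by (intro integrable_integral integrable_continuous_interval)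
    \<comment> \<open>The factor in Cauchy's formula; dividing by it is possible because the loop
      winds around \<open>z\<close>.\<close>
    define n where "n = 2 * pi * \<i> * winding_number p z"
    have "n \<noteq> 0"
      using z by (simp add: n_def)
    define G where "G = emb (inverse n) * integral {0..1} H"
    have "check G t = S z (check f) t" for t
    proof (cases "t \<in> shilov")
      case t: True
      have tc: "t \<in> chars"
        by (rule shilov_chars[OF t])
      have "((\<lambda>c. S c (check f) t / (c - z)) has_contour_integral
          (2 * pi * \<i> * winding_number p z * S z (check f) t)) p"
      proof (rule Cauchy_integral_formula_convex_simple[of "ball 0 1"])
        show "(\<lambda>c. S c (check f) t) holomorphic_on ball 0 1"
          by (rule check_resolvent_holomorphic[OF _ S check_in_C t]) auto
      qed (use p z zD in \<open>auto simp: valid_path_polynomial_function\<close>)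
      then have "((\<lambda>s. S (p s) (check f) t / (p s - z) * vector_derivative p (at s))
          has_integral n * S z (check f) t) {0..1}"
        by (simp add: has_contour_integral n_def)
      then have "((\<lambda>s. S (p s) (check f) t / (p s - z) * p' s)
          has_integral n * S z (check f) t) {0..1}"
        by (simp add: vector_derivative_at[OF p'(2)])
      moreover have "t (H s) = S (p s) (check f) t / (p s - z) * p' s" if s: "s \<in> {0..1}" for s
      proof -
        \<comment> \<open>On the loop the two resolvents agree; elsewhere in the disc only
          \<open>S\<close> is known to exist.\<close>
        have "S (p s) (check f) = check (R (p s) f)"
          using S_check[OF ps(1)[OF s], of "R (p s) f"] shift_R[OF ps(2)[OF s]] by simp
        then show ?thesis
          using t by (simp add: H_def char_emb_mult[OF tc] check_def)
      qed
      ultimately have "((\<lambda>s. t (H s)) has_integral n * S z (check f) t) {0..1}"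
        using has_integral_eq[of "{0..1}" "\<lambda>s. S (p s) (check f) t / (p s - z) * p' s"] by auto
      moreover have "((\<lambda>s. t (H s)) has_integral t (integral {0..1} H)) {0..1}"
        using has_integral_linear[OF int bounded_linear_char[OF tc]] by (simp add: o_def)
      ultimately have "t (integral {0..1} H) = n * S z (check f) t"
        using has_integral_unique by blast
      then show ?thesis
        using t \<open>n \<noteq> 0\<close> by (simp add: check_def G_def char_emb_mult[OF tc])
    next
      case False
      then show ?thesis
        using C_outside[OF check_inverse_in_C[OF S[OF zD] check_in_C]] by (simp add: check_def)
    qed
    then have eq: "check G = S z (check f)"
      by blast
    have "check (shift z G) = check f"
      unfolding check_shift[symmetric] eq
      by (simp add: check_inverse_right[OF S[OF zD] check_in_C])
    then show ?thesis
      using check_eqD by blast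
  qed
  then have "surj (shift z)"
    by (metis surjI)
  moreover have "inj (shift z)"
  proof (rule injI)
    fix f g assume "shift z f = shift z g"
    then have "check f = check g"
      using S_check[OF zD, of f] S_check[OF zD, of g] by simp
    then show "f = g"
      by (rule check_eqD)
  qed
  ultimately show ?thesis
    using zD by (simp add: resolvent_set_def bij_def)
qed

corollary connected_spectrum_Un_exterior:
  assumes "\<And>c. cmod c < 1 \<Longrightarrow> c \<notin> check_spectrum j Tc"
  shows "connected (op_spectrum j T \<union> - ball 0 1)"
proof -
  have "connected (- (ball 0 1 \<inter> resolvent_set))"
    by (rule connected_Compl_if_loops_filled)
      (use loop_filled[OF assms] open_resolvent_set in \<open>auto intro: bounded_Int\<close>)
  then show ?thesis
    by (simp add: op_spectrum_eq Un_commute)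
qed

end

section \<open>Passing to the inverse operator\<close>

lemma (in weighted_automorphism) weighted_automorphism_inverse: "weighted_automorphism j (inv U)"
  using semisimple automorphism_inv[OF automorphism] by unfold_locales

text \<open>The inverse of \<open>f \<mapsto> w * U f\<close> is
  \<open>f \<mapsto> inv U (v * f)\<close>, which explains the weight \<open>inv U v\<close>. A
  nonzero \<open>\<mu>\<close> in the disc is the reciprocal of a point outside it; at
  \<open>\<mu> = 0\<close> the inverse sought is \<open>Tc\<close>.\<close>

lemma (in weighted_automorphism) check_spectrum_inverse:
  assumes v: "w * v = 1" and noncheck: "\<And>c. cmod c > 1 \<Longrightarrow> c \<notin> check_spectrum j Tc" and "cmod \<mu> < 1"
  shows "\<mu> \<notin> check_spectrum j (check_op j (inv U v) (inv U))"
proof -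
  interpret V: weighted_automorphism j "inv U" "inv U v"
    by (rule weighted_automorphism_inverse)
  have UI: "U (inv U x) = x" "inv U (U x) = x" for x
    using automorphism by (auto simp: algebra_automorphism_def bij_is_inj bij_is_surj surj_f_inv_f)
  have unit: "inv U v * inv U w = 1"
    using V.automorphism v by (metis algebra_automorphism_def mult.commute)
  have VT: "V.Tc (Tc g) = g" if "g \<in> C" for g
  proof
    fix t
    show "V.Tc (Tc g) t = g t"
    proof (cases "t \<in> shilov")
      case True
      then have "V.Tc (Tc g) t = t (inv U v * inv U w) * g t"
        using V.shilov_U[OF True] char_mult[OF shilov_chars[OF True]]
        by (simp add: check_op_def o_def UI)
      then show ?thesis
        by (simp add: unit char_1[OF shilov_chars[OF True]])
    qed (use that in \<open>simp add: C_outside check_op_def\<close>)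
  qed
  have TV: "Tc (V.Tc g) = g" if "g \<in> C" for g
  proof
    fix t
    show "Tc (V.Tc g) t = g t"
    proof (cases "t \<in> shilov")
      case True
      then have "Tc (V.Tc g) t = t (w * v) * g t"
        using shilov_U[OF True] char_mult[OF shilov_chars[OF True]]
        by (simp add: check_op_def o_def UI)
      then show ?thesis
        by (simp add: v char_1[OF shilov_chars[OF True]])
    qed (use that in \<open>simp add: C_outside check_op_def\<close>)
  qed
  show ?thesis
  proof (cases "\<mu> = 0")
    case True
    have "V.check_inverse 0 Tc"
      unfolding V.check_inverse_def
    proof (intro conjI ballI exI)
      fix g assume g: "g \<in> C"
      show "V.sup_norm (Tc g) \<le> norm w * V.sup_norm g"
      proof (rule V.sup_norm_leI)
        fix t assume t: "t \<in> shilov"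
        have "cmod (Tc g t) = cmod (t w) * cmod (g (t \<circ> U))"
          using t by (simp add: check_op_def norm_mult)
        also have "\<dots> \<le> norm w * V.sup_norm g"
          using char_le_norm[OF shilov_chars[OF t]] V.eval_le_sup_norm[OF g shilov_U[OF t]]
          by (intro mult_mono) auto
        finally show "cmod (Tc g t) \<le> norm w * V.sup_norm g" .
      qed
    qed (auto simp: Tc_in_C VT TV)
    then show ?thesis
      unfolding V.notin_check_spectrum_iff True by blast
  next
    case False
    define c where "c = inverse \<mu>"
    have "cmod c > 1"
      using False \<open>cmod \<mu> < 1\<close> by (simp add: c_def norm_inverse one_less_inverse)
    then obtain S where S: "check_inverse c S"
      using noncheck notin_check_spectrum_iff by blast
    have c\<mu>: "c * \<mu> = 1" "\<mu> * c = 1"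
      using False by (auto simp: c_def)
    \<comment> \<open>From \<open>Tc\<inverse> - \<mu> = - \<mu> Tc\<inverse> (Tc - c)\<close>: the
      inverse is \<open>- c S Tc\<close>, and \<open>S Tc\<close> is \<open>1 + c S\<close>.\<close>
    define S' where "S' g = (\<lambda>t. (- c) * g t + (- c * c) * S g t)" for g
    have S'_C: "S' g \<in> C" if "g \<in> C" for g
      unfolding S'_def using that check_inverse_in_C[OF S] by (intro C_linear) auto
    obtain K where K: "\<And>g. g \<in> C \<Longrightarrow> sup_norm (S g) \<le> K * sup_norm g"
      using check_inverse_bound[OF S] by blast
    have "V.check_inverse \<mu> S'"
      unfolding V.check_inverse_def
    proof (intro conjI ballI exI)
      fix g assume g: "g \<in> C"
      show "S' g \<in> C"
        by (rule S'_C[OF g])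
      show "S' (\<lambda>t. V.Tc g t - \<mu> * g t) = g"
      proof -
        have "S (\<lambda>t. V.Tc g t - \<mu> * g t) = (\<lambda>t. (- \<mu>) * V.Tc g t + 0 * g t)"
        proof (rule check_inverse_eqI[OF S])
          show "(\<lambda>t. (- \<mu>) * V.Tc g t + 0 * g t) \<in> C"
            using g V.Tc_in_C by (intro C_linear)
          show "Tc (\<lambda>t. (- \<mu>) * V.Tc g t + 0 * g t) t - c * ((- \<mu>) * V.Tc g t + 0 * g t)
              = V.Tc g t - \<mu> * g t" for t
            unfolding Tc_linear TV[OF g] using c\<mu> by (simp add: algebra_simps flip: mult.assoc)
        qed
        then show ?thesis
          using c\<mu> by (auto simp: S'_def algebra_simps simp flip: mult.assoc)
      qed
      show "(\<lambda>t. V.Tc (S' g) t - \<mu> * S' g t) = g"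
      proof
        fix t
        have "S' g = (\<lambda>t. (- c) * Tc (S g) t + 0 * g t)"
          by (auto simp: S'_def check_inverse_right[OF S g] algebra_simps)
        then have "V.Tc (S' g) t = - c * V.Tc (Tc (S g)) t + 0 * V.Tc g t"
          by (simp only: V.Tc_linear)
        also have "\<dots> = - c * S g t"
          by (simp add: VT[OF check_inverse_in_C[OF S g]])
        finally show "V.Tc (S' g) t - \<mu> * S' g t = g t"
          using c\<mu> by (simp add: S'_def algebra_simps flip: mult.assoc)
      qed
      have "V.sup_norm (S' g) \<le> cmod (- c) * V.sup_norm g + cmod (- c * c) * V.sup_norm (S g)"
        unfolding S'_def using V.sup_norm_linear[OF g check_inverse_in_C[OF S g]] .
      also have "\<dots> \<le> cmod (- c) * V.sup_norm g + cmod (- c * c) * (K * V.sup_norm g)"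
        using K[OF g] by (intro add_left_mono mult_left_mono) auto
      finally show "V.sup_norm (S' g) \<le> (cmod (- c) + cmod (- c * c) * K) * V.sup_norm g"
        by (simp add: algebra_simps)
    qed
    then show ?thesis
      unfolding V.notin_check_spectrum_iff by blast
  qed
qed

lemma (in weighted_automorphism) op_spectrum_inverse:
  assumes v: "w * v = 1"
  shows "op_spectrum j (\<lambda>f. inv U v * inv U f) = inverse ` op_spectrum j T" and "0 \<notin> op_spectrum j T"
proof -
  interpret V: weighted_automorphism j "inv U" "inv U v"
    by (rule weighted_automorphism_inverse)
  have UI: "U (inv U x) = x" "inv U (U x) = x" for x
    using automorphism by (auto simp: algebra_automorphism_def bij_is_inj bij_is_surj surj_f_inv_f)
  have V_mult: "inv U x * inv U y = inv U (x * y)" for x y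
    using V.automorphism by (simp add: algebra_automorphism_def)
  have TV: "T (V.T f) = f" for f
    using v by (simp add: T_def V.T_def V_mult UI flip: mult.assoc)
  have VT: "V.T (T f) = f" for f
    using v by (simp add: T_def V.T_def V_mult UI mult.commute[of v] flip: mult.assoc) 
  have bijV: "bij V.T"
    by (rule o_bij[of T]) (auto simp: fun_eq_iff TV VT)
  have bijT: "bij T"
    by (rule o_bij[of V.T]) (auto simp: fun_eq_iff TV VT)
  show z: "0 \<notin> op_spectrum j T"
    using bijT by (simp add: op_spectrum_eq resolvent_set_def shift_def[abs_def])
  have z': "0 \<notin> op_spectrum j V.T"
    using bijV by (simp add: V.op_spectrum_eq V.resolvent_set_def V.shift_def[abs_def])
  have iff: "inverse c \<in> V.resolvent_set \<longleftrightarrow> c \<in> resolvent_set" if "c \<noteq> 0" for c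
  proof -
    \<comment> \<open>\<open>T\<inverse> - 1 / c = - (1 / c) T\<inverse> (T - c)\<close>, whose
      first two factors are bijective.\<close>
    have sh: "V.shift (inverse c) = (\<lambda>x. emb (- inverse c) * x) \<circ> (V.T \<circ> shift c)"
    proof
      fix x
      have "V.T (shift c x) = x - emb c * V.T x"
        by (simp add: shift_def V.T.diff VT V.T_emb)
      then have "((\<lambda>x. emb (- inverse c) * x) \<circ> (V.T \<circ> shift c)) x
          = emb (inverse c) * (emb c * V.T x) - emb (inverse c) * x"
        by (simp add: emb_minus right_diff_distrib)
      then show "V.shift (inverse c) x = ((\<lambda>x. emb (- inverse c) * x) \<circ> (V.T \<circ> shift c)) x"
        using emb_inverse[of "inverse c" "V.T x"] that by (simp add: V.shift_def)
    qed
    have bij_emb: "bij (\<lambda>x. emb (- inverse c) * x)"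
      using that by (intro o_bij[of "\<lambda>x. emb (- c) * x"])
        (auto simp: fun_eq_iff simp flip: mult.assoc emb_mult)
    show ?thesis
      unfolding V.resolvent_set_def resolvent_set_def sh mem_Collect_eq
      using bij_betw_comp_iff2[OF bij_emb, of "V.T \<circ> shift c" UNIV]
        bij_betw_comp_iff2[OF bijV, of "shift c" UNIV] by simp
  qed
  have "op_spectrum j V.T = inverse ` op_spectrum j T"
  proof (intro set_eqI iffI)
    fix c assume c: "c \<in> op_spectrum j V.T"
    then have "c \<noteq> 0"
      using z' by auto
    then have "inverse c \<in> op_spectrum j T"
      using c iff[of "inverse c"] by (simp add: op_spectrum_eq V.op_spectrum_eq)
    then show "c \<in> inverse ` op_spectrum j T"
      by (intro image_eqI[of _ _ "inverse c"]) auto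
  next
    fix c assume "c \<in> inverse ` op_spectrum j T"
    then obtain d where "c = inverse d" "d \<in> op_spectrum j T"
      by blast
    then show "c \<in> op_spectrum j V.T"
      using iff[of d] z by (auto simp: op_spectrum_eq V.op_spectrum_eq)
  qed
  then show "op_spectrum j (\<lambda>f. inv U v * inv U f) = inverse ` op_spectrum j T"
    unfolding V.T_def[abs_def] .
qed

theorem theorem4:
  fixes j :: "'a::{real_normed_algebra_1,comm_ring_1,banach}"
    and U :: "'a \<Rightarrow> 'a" and w :: 'a
  assumes "complex_structure j"
    and "semisimple TYPE('a)"
    and "algebra_automorphism j U"
    and "\<exists>v. w * v = 1"
    and "check_spectrum j (check_op j w U) = sphere 0 1"
    and "sphere 0 1 \<subseteq> op_spectrum j (\<lambda>f. w * U f)"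
  shows "connected (op_spectrum j (\<lambda>f. w * U f))"
proof -
  interpret weighted_automorphism j U w
    by unfold_locales (use assms in auto)
  obtain v where v: "w * v = 1"
    using assms(4) by blast
  interpret V: weighted_automorphism j "inv U" "inv U v"
    by (rule weighted_automorphism_inverse)
  have T_eq: "(\<lambda>f. w * U f) = T"
    by (auto simp: T_def)
  define \<sigma> where "\<sigma> = op_spectrum j T"
  have circle: "sphere 0 1 \<subseteq> \<sigma>"
    using assms(6) by (simp add: \<sigma>_def T_eq)
  have \<sigma>: "closed \<sigma>" "bounded \<sigma>"
    using open_resolvent_set bounded_Compl_resolvent_set by (auto simp: \<sigma>_def op_spectrum_eq)
  have inv_\<sigma>: "op_spectrum j V.T = inverse ` \<sigma>" and zero: "0 \<notin> \<sigma>"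
    using op_spectrum_inverse[OF v] by (simp_all add: \<sigma>_def V.T_def[abs_def])
  have conn: "connected (\<sigma> \<union> - ball 0 1)"
    unfolding \<sigma>_def using assms(5) by (intro connected_spectrum_Un_exterior) auto
  have conn': "connected (inverse ` \<sigma> \<union> - ball 0 1)"
    unfolding inv_\<sigma>[symmetric]
    using assms(5) by (intro V.connected_spectrum_Un_exterior check_spectrum_inverse[OF v]) auto
  \<comment> \<open>The connected circle lies in one piece \<open>A\<close> of any splitting. The
    rest \<open>B\<close> avoids the circle, and its parts inside and outside are ruled out
    separately.\<close>
  have no_split: "B = {}"
    if "closed A" "closed B" and AB: "A \<union> B = \<sigma>" "A \<inter> B = {}" and sphere: "sphere 0 1 \<subseteq> A" for A B
  proof -
    have B1: "cmod b \<noteq> 1" if "b \<in> B" for b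
      using that AB sphere by (auto simp: subset_iff)
    have "B \<inter> cball 0 1 = {}"
    proof (rule ccontr)
      assume ne: "B \<inter> cball 0 1 \<noteq> {}"
      \<comment> \<open>Missing the circle, \<open>B \<inter> cball 0 1\<close> lies in the open
        disc, so it is still split off after the exterior has been adjoined.\<close>
      have "\<sigma> \<union> - ball 0 1 = (B \<inter> cball 0 1) \<union> (A \<union> - ball 0 1)"
        using AB by auto
      moreover have "closed (B \<inter> cball 0 1)" "closed (A \<union> - ball 0 1)"
        using \<open>closed A\<close> \<open>closed B\<close> by auto
      moreover have "(B \<inter> cball 0 1) \<inter> (A \<union> - ball 0 1) = {}"
        using AB B1 by force
      moreover have "1 \<in> A"
        using sphere by auto
      ultimately show False
        using connected_closedD[OF conn, of "B \<inter> cball 0 1" "A \<union> - ball 0 1"] ne by auto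
    qed
    moreover have "B - ball 0 1 = {}"
    proof (rule ccontr)
      define X where "X = inverse ` (B - ball 0 1)"
      define Y where "Y = inverse ` (A - ball 0 1) \<union> - ball 0 1"
      assume "B - ball 0 1 \<noteq> {}"
      then have "X \<noteq> {}"
        by (simp add: X_def)
      \<comment> \<open>Away from the open disc inversion is continuous, and \<open>\<sigma>\<close>
        is bounded; compactness is what makes the images closed.\<close>
      have compact_inverse: "compact (inverse ` (Z - ball 0 1))" if "closed Z" "Z \<subseteq> \<sigma>" for Z
      proof (rule compact_continuous_image)
        show "continuous_on (Z - ball 0 1) inverse"
          by (intro continuous_intros) auto
        have "bounded (Z - ball 0 1)"
          using that \<sigma>(2) bounded_subset by blast
        then show "compact (Z - ball 0 1)"
          using that(1) by (simp add: compact_eq_bounded_closed closed_Diff)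
      qed
      have "A \<subseteq> \<sigma>" "B \<subseteq> \<sigma>"
        using AB by auto
      then have "closed X" "closed Y"
        using compact_inverse[OF \<open>closed A\<close>] compact_inverse[OF \<open>closed B\<close>]
        unfolding X_def Y_def by (simp_all add: compact_imp_closed closed_Un closed_Compl)
      moreover have "inverse ` \<sigma> \<union> - ball 0 1 = X \<union> Y"
      proof -
        \<comment> \<open>Points of the spectrum inside the disc are sent to the adjoined exterior.
          The origin must be kept out of \<open>\<sigma>\<close> here, because
          \<open>inverse 0 = 0\<close> would stay inside.\<close>
        have "inverse c \<in> - ball 0 1" if "c \<in> ball 0 1" "c \<noteq> 0" for c :: complex
          using that by (simp add: norm_inverse inverse_less_1_iff)
        then show ?thesis
          using zero AB unfolding X_def Y_def by blast
      qed
      moreover have "X \<inter> Y = {}"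
      proof -
        have "cmod (inverse b) < 1" if "b \<in> B - ball 0 1" for b
          using that B1[of b] by (auto simp: norm_inverse inverse_less_1_iff)
        then show ?thesis
          using AB(2) unfolding X_def Y_def by fastforce
      qed
      moreover have "1 \<in> Y"
        by (simp add: Y_def)
      ultimately show False
        using connected_closedD[OF conn', of X Y] \<open>X \<noteq> {}\<close> by auto
    qed
    ultimately show ?thesis
      by force
  qed
  have "connected \<sigma>"
    unfolding connected_closed_set[OF \<sigma>(1)]
  proof (rule notI, elim exE conjE)
    fix A B :: "complex set"
    assume AB: "closed A" "closed B" "A \<noteq> {}" "B \<noteq> {}" "A \<union> B = \<sigma>" "A \<inter> B = {}"
    have "connected (sphere (0::complex) 1)"
      by (simp add: connected_sphere)
    then have "sphere 0 1 \<inter> A = {} \<or> sphere 0 1 \<inter> B = {}"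
      using connected_closedD[of "sphere 0 1" A B] AB circle by blast
    then have "sphere 0 1 \<subseteq> A \<or> sphere 0 1 \<subseteq> B"
      using circle AB by blast
    then show False
      using no_split[of A B] no_split[of B A] AB by blast
  qed
  then show ?thesis
    by (simp add: \<sigma>_def T_eq)
qed

end
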